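(* Let $\mathcal{L}(\Gamma)$ be the generalized loop Heisenberg-Virasoro algebra. Then $$\mathrm{Der}\,\mathcal{L}(\Gamma)=\mathrm{ad}(\mathcal{L}(\Gamma))+\left(\mathcal{D}_{\mathrm{Hom}_{\mathbb{Z}}(\Gamma,\mathbb{F}[t,t^{-1}])}\oplus\mathcal{D}_{\mathbf{g}(\Gamma)}\oplus\mathcal{D}_{\mathbb{F}[t,t^{-1}]}\oplus\mathcal{D}_{\mathbb{F}[t,t^{-1}]\frac{d}{dt}}\right).$$
   Context: $\mathbb{F}$ is an algebraically closed field of characteristic zero; all vector spaces and algebras are over $\mathbb{F}$. $\Gamma$ is an additive subgroup of $\mathbb{F}$. The generalized loop Heisenberg-Virasoro algebra $\mathcal{L}(\Gamma)$ is the Lie algebra over $\mathbb{F}$ with basis $\{L_{\alpha,i},H_{\beta,j}\mid \alpha,\beta\in\Gamma,\ i,j\in\mathbb{Z}\}$ and brackets $[L_{\alpha,i},L_{\beta,j}]=(\alpha-\beta)L_{\alpha+\beta,i+j}$, $[L_{\alpha,i},H_{\beta,j}]=-\beta H_{\alpha+\beta,i+j}$, $[H_{\alpha,i},H_{\beta,j}]=0$. $\mathrm{Der}\,\mathcal{L}(\Gamma)$ is the space of all derivations of $\mathcal{L}(\Gamma)$ (linear maps $\mathcal{D}$ with $\mathcal{D}([x,y])=[\mathcal{D}(x),y]+[x,\mathcal{D}(y)]$), and $\mathrm{ad}(\mathcal{L}(\Gamma))$ is the space of inner derivations. For $p=\sum_k p_k t^k\in\mathbb{F}[t,t^{-1}]$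 write $L_\alpha p=\sum_k p_kL_{\alpha,k}$ and $H_\alpha p=\sum_k p_kH_{\alpha,k}$; thus $L_{\alpha,i}=L_\alpha t^i$, $H_{\alpha,i}=H_\alpha t^i$, and $\mathbb{F}[t,t^{-1}]$ acts on $\mathcal{L}(\Gamma)$ by $p\,L_{\alpha,i}=L_\alpha(pt^i)$, $p\,H_{\alpha,i}=H_\alpha(pt^i)$. Let $\mathrm{Hom}_{\mathbb{Z}}(\Gamma,\mathbb{F}[t,t^{-1}])$ be the set of additive group homomorphisms $\Gamma\to\mathbb{F}[t,t^{-1}]$, let $$\mathbf{g}(\Gamma)=\{g:\Gamma\to\mathbb{F}[t,t^{-1}]\mid(\alpha-\beta)g_{\alpha+\beta}=\alpha g_\alpha-\beta g_\beta\ \text{for all }\alpha,\beta\in\Gamma\}$$ (where $g_\alpha$ is the image of $\alpha$ under $g$), and let $\mathbb{F}[t,t^{-1}]\frac{d}{dt}$ be the derivation algebra of $\mathbb{F}[t,t^{-1}]$. For $\phi\in\mathrm{Hom}_{\mathbb{Z}}(\Gamma,\mathbb{F}[t,t^{-1}])$, $g\in\mathbf{g}(\Gamma)$, $b\in\mathbb{F}[t,t^{-1}]$, $\rho\in\mathbb{F}[t,t^{-1}]\frac{d}{dt}$ define linear maps on $\mathcal{L}(\Gamma)$ by, for all $\alpha\in\Gamma$, $i\in\mathbb{Z}$: $D_\phi(L_{\alpha,i})=\phi(\alpha)L_{\alpha,i}$, $D_\phi(H_{\alpha,i})=\phi(\alpha)H_{\alpha,i}$; $D_g(L_{\alpha,i})=g_\alpha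 H_{\alpha,i}$, $D_g(H_{\alpha,i})=0$; $D_b(L_{\alpha,i})=0$, $D_b(H_{\alpha,i})=bH_{\alpha,i}$; $D^\rho(L_{\alpha,i})=L_\alpha\rho(t^i)$, $D^\rho(H_{\alpha,i})=H_\alpha\rho(t^i)$. These are derivations of $\mathcal{L}(\Gamma)$. Set $\mathcal{D}_{\mathrm{Hom}_{\mathbb{Z}}(\Gamma,\mathbb{F}[t,t^{-1}])}=\{D_\phi\}$, $\mathcal{D}_{\mathbf{g}(\Gamma)}=\{D_g\}$, $\mathcal{D}_{\mathbb{F}[t,t^{-1}]}=\{D_b\}$, $\mathcal{D}_{\mathbb{F}[t,t^{-1}]\frac{d}{dt}}=\{D^\rho\}$, with $\phi,g,b,\rho$ ranging over the respective sets.
   Formalization: The formal theorem assumes Γ ≠ {0}; for Γ = {0} the algebra is abelian and the equality fails, since the derivation H_{0,i} ↦ L_{0,i}, L_{0,i} ↦ 0 is not in the right-hand side. *)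

theory Defs
  imports
    "HOL-Library.Poly_Mapping"
    "HOL-Library.Set_Algebras"
    "HOL-Library.Function_Algebras"
    "HOL-Computational_Algebra.Polynomial"
begin

definition add_subgroup :: "'a::group_add set \<Rightarrow> bool" where
  "add_subgroup \<Gamma> \<longleftrightarrow> 0 \<in> \<Gamma> \<and> (\<forall>x\<in>\<Gamma>. \<forall>y\<in>\<Gamma>. x + y \<in> \<Gamma>) \<and> (\<forall>x\<in>\<Gamma>. - x \<in> \<Gamma>)"


section \<open>Vector spaces of finitely supported functions\<close>

text \<open>
  The space with basis \<open>'k\<close> over a field \<open>'a\<close> is \<open>'k \<Rightarrow>\<^sub>0 'a\<close>; the basis vector of index \<open>k\<close> is
  \<open>Poly_Mapping.single k 1\<close>.
\<close>

definition scale :: "'a::field \<Rightarrow> ('k \<Rightarrow>\<^sub>0 'a) \<Rightarrow> ('k \<Rightarrow>\<^sub>0 'a)" where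
  "scale c x = Poly_Mapping.map ((*) c) x"

lemma lookup_scale [simp]: "Poly_Mapping.lookup (scale c x) k = c * Poly_Mapping.lookup x k"
  unfolding scale_def by (transfer) (auto simp: when_def)

global_interpretation pm: vector_space scale
  by standard (auto intro!: poly_mapping_eqI simp: lookup_add algebra_simps)

definition lift :: "('k \<Rightarrow> ('l \<Rightarrow>\<^sub>0 'a::field)) \<Rightarrow> ('k \<Rightarrow>\<^sub>0 'a) \<Rightarrow> ('l \<Rightarrow>\<^sub>0 'a)" where
  "lift f x = (\<Sum>k\<in>Poly_Mapping.keys x. scale (Poly_Mapping.lookup x k) (f k))"

lemma lift_superset:
  assumes "finite A" "Poly_Mapping.keys x \<subseteq> A"
  shows "lift f x = (\<Sum>k\<in>A. scale (Poly_Mapping.lookup x k) (f k))"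
  unfolding lift_def using assms
  by (intro sum.mono_neutral_left) (auto simp: in_keys_iff)

lemma lift_add: "lift f (x + y) = lift f x + lift f y"
proof -
  let ?A = "Poly_Mapping.keys x \<union> Poly_Mapping.keys y"
  have "Poly_Mapping.keys (x + y) \<subseteq> ?A" by (rule Poly_Mapping.keys_add)
  then show ?thesis
    by (simp add: lift_superset[of ?A] lookup_add pm.scale_left_distrib sum.distrib)
qed

lemma lift_scale: "lift f (scale c x) = scale c (lift f x)"
proof -
  have "Poly_Mapping.keys (scale c x) \<subseteq> Poly_Mapping.keys x"
    by (auto simp: in_keys_iff)
  then show ?thesis
    by (simp add: lift_superset[of "Poly_Mapping.keys x"] pm.scale_sum_right)
qed

lemma lift_single [simp]: "lift f (Poly_Mapping.single k c) = scale c (f k)"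
  by (simp add: lift_def)

lemma pm_sum_basis: "x = (\<Sum>k\<in>Poly_Mapping.keys x. scale (Poly_Mapping.lookup x k) (Poly_Mapping.single k 1))"
  by (rule poly_mapping_eqI) (auto simp: lookup_sum lookup_single when_def in_keys_iff if_distrib cong: if_cong)

lemma pm_linear_eqI:
  assumes f: "Vector_Spaces.linear scale scale f" and g: "Vector_Spaces.linear scale scale g"
    and eq: "\<And>k. f (Poly_Mapping.single k 1) = g (Poly_Mapping.single k 1)"
  shows "f x = g x"
proof -
  interpret f: Vector_Spaces.linear scale scale f by fact
  interpret g: Vector_Spaces.linear scale scale g by fact
  show ?thesis
    by (subst (1 2) pm_sum_basis) (simp only: f.sum g.sum f.scale g.scale eq)
qed

lemma pm_linearI:
  assumes "\<And>x y. f (x + y) = f x + f y" "\<And>c x. f (scale c x) = scale c (f x)"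
  shows "Vector_Spaces.linear scale scale f"
  using assms by unfold_locales auto

lemma linear_lift: "Vector_Spaces.linear scale scale (lift f)"
  by (rule pm_linearI) (rule lift_add lift_scale)+


section \<open>Laurent polynomials\<close>

text \<open>
  The product on \<open>int \<Rightarrow>\<^sub>0 'a\<close> is convolution, so this type is the ring of Laurent polynomials,
  with \<open>Poly_Mapping.single i 1\<close> being the \<open>i\<close>-th power of the variable.
\<close>

type_synonym 'a laurent = "int \<Rightarrow>\<^sub>0 'a"

definition tpow :: "int \<Rightarrow> 'a::field laurent" where
  "tpow i = Poly_Mapping.single i 1"

definition ddt :: "'a::field laurent \<Rightarrow> 'a laurent" where
  "ddt = lift (\<lambda>k. scale (of_int k) (tpow (k - 1)))"

definition laurent_ders :: "('a::field laurent \<Rightarrow> 'a laurent) set" where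
  "laurent_ders = {(\<lambda>f. p * ddt f) | p. True}"

lemma scale_eq_mult: "scale c p = Poly_Mapping.single 0 c * (p :: 'a::field laurent)"
proof (rule poly_mapping_eqI)
  fix k
  have "(\<Sum>l. c * (\<Sum>q. Poly_Mapping.lookup p q when k = l + q) when l = 0)
     = c * (\<Sum>q. Poly_Mapping.lookup p q when k = q)" by simp
  also have "\<dots> = c * Poly_Mapping.lookup p k" by simp
  finally show "Poly_Mapping.lookup (scale c p) k = Poly_Mapping.lookup (Poly_Mapping.single 0 c * p) k"
    by (simp add: lookup_mult lookup_single when_mult)
qed

lemma tpow_add: "tpow (i + j) = tpow i * (tpow j :: 'a::field laurent)"
  by (simp add: tpow_def mult_single)

lemma tpow_0: "tpow 0 = (1 :: 'a::field laurent)"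
  by (simp add: tpow_def)

lemma scale_mult_left: "scale c p * q = scale c (p * q :: 'a::field laurent)"
  by (simp add: scale_eq_mult mult.assoc)
lemma scale_mult_right: "p * scale c q = scale c (p * q :: 'a::field laurent)"
  by (simp add: scale_eq_mult mult.left_commute)

lemma ddt_tpow: "ddt (tpow k) = scale (of_int k) (tpow (k - 1))"
  by (simp add: ddt_def tpow_def)

lemma ddt_add: "ddt (x + y) = ddt x + ddt y" by (simp add: ddt_def lift_add)
lemma ddt_scale: "ddt (scale c y) = scale c (ddt y)" by (simp add: ddt_def lift_scale)

lemma ddt_mult: "ddt (x * y) = ddt x * y + x * ddt (y :: 'a::field laurent)"
proof -
  have 1: "ddt (tpow i * tpow j) = ddt (tpow i) * tpow j + tpow i * (ddt (tpow j) :: 'a laurent)" for i j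
    by (simp add: ddt_tpow scale_mult_left scale_mult_right flip: tpow_add)
       (simp add: algebra_simps flip: pm.scale_left_distrib)
  have 2: "ddt (tpow i * y) = ddt (tpow i) * y + tpow i * ddt y" for i and y :: "'a laurent"
    by (rule pm_linear_eqI, (rule pm_linearI;
          simp add: distrib_left distrib_right add_ac ddt_add ddt_scale scale_mult_right pm.scale_right_distrib)+)
       (use 1 in \<open>simp add: tpow_def\<close>)
  show ?thesis
    by (rule pm_linear_eqI[where x = x], (rule pm_linearI;
          simp add: distrib_left distrib_right add_ac ddt_add ddt_scale scale_mult_left pm.scale_right_distrib)+)
       (use 2 in \<open>simp add: tpow_def\<close>)
qed

lemma laurent_ders_eq:
  "laurent_ders = {d :: 'a::field laurent \<Rightarrow> 'a laurent.
     Vector_Spaces.linear scale scale d \<and> (\<forall>x y. d (x * y) = d x * y + x * d y)}" (is "_ = ?R")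
proof (intro equalityI subsetI)
  fix d :: "'a laurent \<Rightarrow> 'a laurent" assume "d \<in> laurent_ders"
  then obtain p where d: "d = (\<lambda>f. p * ddt f)" by (auto simp: laurent_ders_def)
  have "Vector_Spaces.linear scale scale d"
    by (rule pm_linearI) (simp_all add: d ddt_add ddt_scale distrib_left scale_mult_right)
  then show "d \<in> ?R" by (simp add: d ddt_mult algebra_simps)
next
  fix d :: "'a laurent \<Rightarrow> 'a laurent" assume "d \<in> ?R"
  then have lin: "Vector_Spaces.linear scale scale d" and m: "\<And>x y. d (x * y) = d x * y + x * d y"
    by auto
  define p where "p = d (tpow 1)"
  have "d (1 * 1) = d 1 * 1 + 1 * d 1" by (rule m)
  then have "d 1 + d 1 = d 1 + 0" by simp
  then have one: "d 1 = 0" by (simp only: add_left_cancel)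
  have shift: "d (tpow k * tpow 1) = d (tpow k) * tpow 1 + tpow k * p" for k
    by (simp add: m p_def)
  have inv: "tpow 1 * tpow (- 1) = (1 :: 'a laurent)" by (simp add: tpow_0 flip: tpow_add)
  have inv': "x * tpow 1 * tpow (- 1) = (x :: 'a laurent)" for x
    by (simp add: mult.assoc inv)
  have pw: "d (tpow k) = p * ddt (tpow k)" for k
  proof (induction k rule: int_induct[where k = 0])
    case base then show ?case using ddt_tpow[of 0, where 'a='a] by (simp add: tpow_0 one)
  next
    case (step1 i)
    have "d (tpow (i + 1)) = p * ddt (tpow i) * tpow 1 + tpow i * p"
      using shift[of i] step1 by (simp add: tpow_add)
    also have "\<dots> = p * ddt (tpow i * tpow 1)"
      by (simp add: ddt_mult ddt_tpow[of 1] tpow_0 algebra_simps)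
    finally show ?case by (simp add: tpow_add)
  next
    case (step2 i)
    have e: "tpow (i - 1) * tpow 1 = (tpow i :: 'a laurent)" by (simp flip: tpow_add)
    have "d (tpow (i - 1)) * tpow 1 = p * ddt (tpow i) - tpow (i - 1) * p"
      using shift[of "i - 1"] step2 by (simp add: e)
    also have "p * ddt (tpow i) = p * ddt (tpow (i - 1) * tpow 1)" by (simp add: e)
    also have "\<dots> - tpow (i - 1) * p = p * ddt (tpow (i - 1)) * tpow 1"
      by (simp add: ddt_mult ddt_tpow[of 1] tpow_0 algebra_simps)
    finally show ?case by (metis inv')
  qed
  have "d = (\<lambda>f. p * ddt f)"
  proof
    fix f show "d f = p * ddt f"
      by (rule pm_linear_eqI[OF lin pm_linearI])
         (simp_all add: ddt_add ddt_scale distrib_left scale_mult_right pw flip: tpow_def)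
  qed
  then show "d \<in> laurent_ders" by (auto simp: laurent_ders_def)
qed


section \<open>The generalized loop Heisenberg-Virasoro algebra\<close>

datatype 'a hv_index = LI 'a int | HI 'a int

type_synonym 'a hv = "'a hv_index \<Rightarrow>\<^sub>0 'a"

definition L_basis :: "'a::field \<Rightarrow> int \<Rightarrow> 'a hv" where
  "L_basis \<alpha> i = Poly_Mapping.single (LI \<alpha> i) 1"

definition H_basis :: "'a::field \<Rightarrow> int \<Rightarrow> 'a hv" where
  "H_basis \<alpha> i = Poly_Mapping.single (HI \<alpha> i) 1"

fun bracket_index :: "'a::field hv_index \<Rightarrow> 'a hv_index \<Rightarrow> 'a hv" where
  "bracket_index (LI \<alpha> i) (LI \<beta> j) = scale (\<alpha> - \<beta>) (L_basis (\<alpha> + \<beta>) (i + j))"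
| "bracket_index (LI \<alpha> i) (HI \<beta> j) = scale (- \<beta>) (H_basis (\<alpha> + \<beta>) (i + j))"
| "bracket_index (HI \<alpha> i) (LI \<beta> j) = scale \<alpha> (H_basis (\<alpha> + \<beta>) (i + j))"
| "bracket_index (HI \<alpha> i) (HI \<beta> j) = 0"

definition bracket :: "'a::field hv \<Rightarrow> 'a hv \<Rightarrow> 'a hv" where
  "bracket x y = lift (\<lambda>u. lift (bracket_index u) y) x"

text \<open>
  Since \<open>\<Gamma>\<close> is a set rather than a type, the algebra is a subspace of the type \<open>'a hv\<close>.
\<close>

definition hv_algebra :: "'a::field set \<Rightarrow> 'a hv set" where
  "hv_algebra \<Gamma> = {x. Poly_Mapping.keys x \<subseteq> {LI \<alpha> i | \<alpha> i. \<alpha> \<in> \<Gamma>} \<union> {HI \<alpha> i | \<alpha> i. \<alpha> \<in> \<Gamma>}}"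

lemma bracket_basis:
  "bracket (L_basis \<alpha> i) (L_basis \<beta> j) = scale (\<alpha> - \<beta>) (L_basis (\<alpha> + \<beta>) (i + j))"
  "bracket (L_basis \<alpha> i) (H_basis \<beta> j) = scale (- \<beta>) (H_basis (\<alpha> + \<beta>) (i + j))"
  "bracket (H_basis \<alpha> i) (L_basis \<beta> j) = scale \<alpha> (H_basis (\<alpha> + \<beta>) (i + j))"
  "bracket (H_basis \<alpha> i) (H_basis \<beta> j) = 0"
  by (simp_all add: bracket_def L_basis_def H_basis_def)

lemma bracket_linear_left: "Vector_Spaces.linear scale scale (\<lambda>x. bracket x y)"
  unfolding bracket_def by (rule linear_lift)

lemma lift_fun_add: "lift (\<lambda>u. f u + g u) x = lift f x + lift g x"
  by (simp add: lift_def pm.scale_right_distrib sum.distrib)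
lemma lift_fun_scale: "lift (\<lambda>u. scale c (f u)) x = scale c (lift f x)"
  by (simp add: lift_def pm.scale_sum_right mult.commute)

lemma bracket_linear_right: "Vector_Spaces.linear scale scale (bracket x)"
  unfolding bracket_def
  by (rule pm_linearI) (simp_all add: lift_add lift_scale lift_fun_add lift_fun_scale)

lemma basis_cases:
  obtains (L) \<alpha> i where "Poly_Mapping.single u 1 = L_basis \<alpha> i" | (H) \<alpha> i where "Poly_Mapping.single u 1 = H_basis \<alpha> i"
  unfolding L_basis_def H_basis_def by (cases u) auto

lemmas bracket_hom_left = bracket_linear_left[THEN Vector_Spaces.linear.axioms(3)]
lemmas bracket_hom_right = bracket_linear_right[THEN Vector_Spaces.linear.axioms(3)]
lemmas bracket_simps =
  module_hom.add[OF bracket_hom_left] module_hom.add[OF bracket_hom_right]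
  module_hom.scale[OF bracket_hom_left] module_hom.scale[OF bracket_hom_right]
  module_hom.zero[OF bracket_hom_left] module_hom.zero[OF bracket_hom_right]
  module_hom.neg[OF bracket_hom_left] module_hom.neg[OF bracket_hom_right]

lemma jacobi: "bracket x (bracket y z) + bracket y (bracket z x) + bracket z (bracket x y) = 0"
proof -
  let ?J = "\<lambda>x y z. bracket x (bracket y z) + bracket y (bracket z x) + bracket z (bracket x y)"
  let ?s = "\<lambda>u. Poly_Mapping.single u 1"
  have lz: "Vector_Spaces.linear scale scale (\<lambda>_. 0)" by (rule pm_linearI) auto
  have lin: "Vector_Spaces.linear scale scale (\<lambda>x. ?J x y z)" "Vector_Spaces.linear scale scale (\<lambda>y. ?J x y z)"
     "Vector_Spaces.linear scale scale (\<lambda>z. ?J x y z)" for x y z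
    by (rule pm_linearI; simp add: bracket_simps pm.scale_right_distrib algebra_simps)+
  have 1: "?J (?s u) (?s v) (?s w) = 0" for u v w
    by (rule basis_cases[of u]; rule basis_cases[of v]; rule basis_cases[of w]; simp only: bracket_basis bracket_simps;
        rule poly_mapping_eqI;
        simp add: bracket_basis bracket_simps lookup_add L_basis_def[of "_ + _"] H_basis_def[of "_ + _"] lookup_single add_ac when_def algebra_simps)
  have 2: "?J (?s u) (?s v) z = 0" for u v z using pm_linear_eqI[OF lin(3) lz] 1 by blast
  have 3: "?J (?s u) y z = 0" for u y z using pm_linear_eqI[OF lin(2) lz] 2 by blast
  show ?thesis using pm_linear_eqI[OF lin(1) lz] 3 by blast
qed

lemma bracket_anti: "bracket x y = - bracket y x"
proof -
  let ?s = "\<lambda>u. Poly_Mapping.single u 1"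
  have lin: "Vector_Spaces.linear scale scale (\<lambda>x. bracket x y)" "Vector_Spaces.linear scale scale (\<lambda>x. bracket y x)"
   "Vector_Spaces.linear scale scale (\<lambda>x. - bracket x y)" "Vector_Spaces.linear scale scale (\<lambda>x. - bracket y x)" for y
    by (rule pm_linearI; simp add: bracket_simps pm.scale_right_distrib algebra_simps)+
  have 1: "bracket (?s u) (?s v) = - bracket (?s v) (?s u)" for u v
    by (rule basis_cases[of u]; rule basis_cases[of v]; rule poly_mapping_eqI;
        simp add: bracket_basis L_basis_def[of "_ + _"] H_basis_def[of "_ + _"] lookup_single add_ac when_def)
  have 2: "bracket (?s u) y = - bracket y (?s u)" for u y using pm_linear_eqI[OF lin(2) lin(3)] 1 by blast
  show ?thesis using pm_linear_eqI[OF lin(1) lin(4)] 2 by blast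
qed

lemma bracket_self: "bracket x x = (0 :: 'a::field_char_0 hv)"
proof (rule poly_mapping_eqI)
  fix k
  have "Poly_Mapping.lookup (bracket x x) k = - Poly_Mapping.lookup (bracket x x) k"
    by (subst (1) bracket_anti) simp
  then show "Poly_Mapping.lookup (bracket x x) k = Poly_Mapping.lookup 0 k" 
    by (simp flip: add_eq_0_iff mult_2) 
qed

lemma hv_sum: "(\<And>i. i \<in> A \<Longrightarrow> f i \<in> hv_algebra G) \<Longrightarrow> sum f A \<in> hv_algebra G"
proof -
  assume h: "\<And>i. i \<in> A \<Longrightarrow> f i \<in> hv_algebra G"
  have "Poly_Mapping.keys (sum f A) \<subseteq> (\<Union>i\<in>A. Poly_Mapping.keys (f i))" by (rule keys_sum)
  then show ?thesis using h unfolding hv_algebra_def by blast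
qed

lemma hv_scale: "x \<in> hv_algebra G \<Longrightarrow> scale c x \<in> hv_algebra G"
  by (auto simp: hv_algebra_def in_keys_iff)
lemma hv_add: "x \<in> hv_algebra G \<Longrightarrow> y \<in> hv_algebra G \<Longrightarrow> x + y \<in> hv_algebra G"
  using Poly_Mapping.keys_add[of x y] unfolding hv_algebra_def by blast

lemma hv_algebra_closed:
  assumes "add_subgroup \<Gamma>" "x \<in> hv_algebra \<Gamma>" "y \<in> hv_algebra \<Gamma>"
  shows "bracket x y \<in> hv_algebra \<Gamma>"
proof -
  have "bracket_index u v \<in> hv_algebra \<Gamma>"
    if "u \<in> Poly_Mapping.keys x" "v \<in> Poly_Mapping.keys y" for u v
  proof -
    have LH: "L_basis (\<alpha> + \<beta>) k \<in> hv_algebra \<Gamma>" "H_basis (\<alpha> + \<beta>) k \<in> hv_algebra \<Gamma>"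
      if "\<alpha> \<in> \<Gamma>" "\<beta> \<in> \<Gamma>" for \<alpha> \<beta> k
      using that assms(1) by (auto simp: hv_algebra_def L_basis_def H_basis_def add_subgroup_def)
    have z: "0 \<in> hv_algebra \<Gamma>" by (simp add: hv_algebra_def)
    have "u \<in> {LI \<alpha> i | \<alpha> i. \<alpha> \<in> \<Gamma>} \<union> {HI \<alpha> i | \<alpha> i. \<alpha> \<in> \<Gamma>}"
      "v \<in> {LI \<alpha> i | \<alpha> i. \<alpha> \<in> \<Gamma>} \<union> {HI \<alpha> i | \<alpha> i. \<alpha> \<in> \<Gamma>}"
      using that assms(2,3) unfolding hv_algebra_def by blast+
    then show ?thesis
      by (auto intro!: hv_scale LH z simp del: pm.scale_minus_left)
  qed
  then show ?thesis unfolding bracket_def lift_def by (intro hv_sum hv_scale)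
qed


section \<open>Derivations\<close>

text \<open>
  Linear endomorphisms of \<open>hv_algebra \<Gamma>\<close> are represented by functions on \<open>'a hv\<close> that vanish
  outside \<open>hv_algebra \<Gamma>\<close>, so that equality of functions is equality of endomorphisms.  Their sum
  is the pointwise one, and \<open>A + B\<close> for sets \<open>A\<close>, \<open>B\<close> of endomorphisms is the set of all sums.
\<close>

definition endos :: "'a::field set \<Rightarrow> ('a hv \<Rightarrow> 'a hv) set" where
  "endos \<Gamma> = {D.
     (\<forall>x\<in>hv_algebra \<Gamma>. D x \<in> hv_algebra \<Gamma>) \<and>
     (\<forall>x\<in>hv_algebra \<Gamma>. \<forall>y\<in>hv_algebra \<Gamma>. D (x + y) = D x + D y) \<and>
     (\<forall>c. \<forall>x\<in>hv_algebra \<Gamma>. D (scale c x) = scale c (D x)) \<and>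
     (\<forall>x. x \<notin> hv_algebra \<Gamma> \<longrightarrow> D x = 0)}"

definition Der :: "'a::field set \<Rightarrow> ('a hv \<Rightarrow> 'a hv) set" where
  "Der \<Gamma> = {D \<in> endos \<Gamma>. \<forall>x\<in>hv_algebra \<Gamma>. \<forall>y\<in>hv_algebra \<Gamma>.
     D (bracket x y) = bracket (D x) y + bracket x (D y)}"

definition ad :: "'a::field set \<Rightarrow> 'a hv \<Rightarrow> 'a hv \<Rightarrow> 'a hv" where
  "ad \<Gamma> x = (\<lambda>y. if y \<in> hv_algebra \<Gamma> then bracket x y else 0)"

definition inner_ders :: "'a::field set \<Rightarrow> ('a hv \<Rightarrow> 'a hv) set" where
  "inner_ders \<Gamma> = ad \<Gamma> ` hv_algebra \<Gamma>"

definition hv_extend :: "'a::field set \<Rightarrow> ('a hv_index \<Rightarrow> 'a hv) \<Rightarrow> 'a hv \<Rightarrow> 'a hv" where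
  "hv_extend \<Gamma> f = (\<lambda>x. if x \<in> hv_algebra \<Gamma> then lift f x else 0)"

definition scale_endo :: "'a::field \<Rightarrow> ('a hv \<Rightarrow> 'a hv) \<Rightarrow> 'a hv \<Rightarrow> 'a hv" where
  "scale_endo c D = (\<lambda>x. scale c (D x))"

global_interpretation endo: vector_space scale_endo
  by standard (auto simp: scale_endo_def fun_eq_iff pm.scale_left_distrib pm.scale_right_distrib)

definition direct_sum4 ::
  "('a::field hv \<Rightarrow> 'a hv) set \<Rightarrow> ('a hv \<Rightarrow> 'a hv) set \<Rightarrow> ('a hv \<Rightarrow> 'a hv) set \<Rightarrow> ('a hv \<Rightarrow> 'a hv) set \<Rightarrow> bool"
where
  "direct_sum4 A B C E \<longleftrightarrow>
     endo.subspace A \<and> endo.subspace B \<and> endo.subspace C \<and> endo.subspace E \<and>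
     (\<forall>a\<in>A. \<forall>b\<in>B. \<forall>c\<in>C. \<forall>e\<in>E. a + b + c + e = 0 \<longrightarrow> a = 0 \<and> b = 0 \<and> c = 0 \<and> e = 0)"


section \<open>The outer derivations\<close>

definition L_laurent :: "'a::field \<Rightarrow> 'a laurent \<Rightarrow> 'a hv" where
  "L_laurent \<alpha> = lift (L_basis \<alpha>)"

definition H_laurent :: "'a::field \<Rightarrow> 'a laurent \<Rightarrow> 'a hv" where
  "H_laurent \<alpha> = lift (H_basis \<alpha>)"

fun laurent_act_index :: "'a::field laurent \<Rightarrow> 'a hv_index \<Rightarrow> 'a hv" where
  "laurent_act_index p (LI \<alpha> i) = L_laurent \<alpha> (p * tpow i)"
| "laurent_act_index p (HI \<alpha> i) = H_laurent \<alpha> (p * tpow i)"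

definition laurent_act :: "'a::field laurent \<Rightarrow> 'a hv \<Rightarrow> 'a hv" where
  "laurent_act p = lift (laurent_act_index p)"

text \<open>
  Membership in the next two sets only constrains the values on \<open>\<Gamma>\<close>; the values elsewhere do not
  enter into \<open>D_hom \<Gamma> \<phi>\<close> and \<open>D_g \<Gamma> g\<close>.
\<close>

definition Hom_Z :: "'a::field set \<Rightarrow> ('a \<Rightarrow> 'a laurent) set" where
  "Hom_Z \<Gamma> = {\<phi>. \<forall>\<alpha>\<in>\<Gamma>. \<forall>\<beta>\<in>\<Gamma>. \<phi> (\<alpha> + \<beta>) = \<phi> \<alpha> + \<phi> \<beta>}"

definition g_space :: "'a::field set \<Rightarrow> ('a \<Rightarrow> 'a laurent) set" where
  "g_space \<Gamma> = {g. \<forall>\<alpha>\<in>\<Gamma>. \<forall>\<beta>\<in>\<Gamma>.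
     scale (\<alpha> - \<beta>) (g (\<alpha> + \<beta>)) = scale \<alpha> (g \<alpha>) - scale \<beta> (g \<beta>)}"

definition D_hom :: "'a::field set \<Rightarrow> ('a \<Rightarrow> 'a laurent) \<Rightarrow> 'a hv \<Rightarrow> 'a hv" where
  "D_hom \<Gamma> \<phi> = hv_extend \<Gamma> (\<lambda>u. case u of
      LI \<alpha> i \<Rightarrow> laurent_act (\<phi> \<alpha>) (L_basis \<alpha> i)
    | HI \<alpha> i \<Rightarrow> laurent_act (\<phi> \<alpha>) (H_basis \<alpha> i))"

definition D_g :: "'a::field set \<Rightarrow> ('a \<Rightarrow> 'a laurent) \<Rightarrow> 'a hv \<Rightarrow> 'a hv" where
  "D_g \<Gamma> g = hv_extend \<Gamma> (\<lambda>u. case u of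
      LI \<alpha> i \<Rightarrow> laurent_act (g \<alpha>) (H_basis \<alpha> i)
    | HI \<alpha> i \<Rightarrow> 0)"

definition D_mult :: "'a::field set \<Rightarrow> 'a laurent \<Rightarrow> 'a hv \<Rightarrow> 'a hv" where
  "D_mult \<Gamma> b = hv_extend \<Gamma> (\<lambda>u. case u of
      LI \<alpha> i \<Rightarrow> 0
    | HI \<alpha> i \<Rightarrow> laurent_act b (H_basis \<alpha> i))"

definition D_loop :: "'a::field set \<Rightarrow> ('a laurent \<Rightarrow> 'a laurent) \<Rightarrow> 'a hv \<Rightarrow> 'a hv" where
  "D_loop \<Gamma> \<rho> = hv_extend \<Gamma> (\<lambda>u. case u of
      LI \<alpha> i \<Rightarrow> L_laurent \<alpha> (\<rho> (tpow i))
    | HI \<alpha> i \<Rightarrow> H_laurent \<alpha> (\<rho> (tpow i)))"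

definition Ders_hom :: "'a::field set \<Rightarrow> ('a hv \<Rightarrow> 'a hv) set" where
  "Ders_hom \<Gamma> = D_hom \<Gamma> ` Hom_Z \<Gamma>"

definition Ders_g :: "'a::field set \<Rightarrow> ('a hv \<Rightarrow> 'a hv) set" where
  "Ders_g \<Gamma> = D_g \<Gamma> ` g_space \<Gamma>"

definition Ders_mult :: "'a::field set \<Rightarrow> ('a hv \<Rightarrow> 'a hv) set" where
  "Ders_mult \<Gamma> = D_mult \<Gamma> ` UNIV"

definition Ders_loop :: "'a::field set \<Rightarrow> ('a hv \<Rightarrow> 'a hv) set" where
  "Ders_loop \<Gamma> = D_loop \<Gamma> ` laurent_ders"


section \<open>The zero subgroup\<close>

text \<open>
  For \<open>\<Gamma> = {0}\<close> the algebra is abelian, so every linear endomorphism is a derivation; but the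
  derivations of the five families map \<open>H_basis 0 0\<close> to a combination of the \<open>H_basis 0 i\<close>.
  The decomposition therefore fails in this degenerate case.
\<close>

lemma hv_algebra_zero_cases: "x \<in> hv_algebra {0} \<Longrightarrow> u \<in> Poly_Mapping.keys x \<Longrightarrow> \<exists>i. u = LI 0 i \<or> u = HI 0 i"
  unfolding hv_algebra_def by blast

lemma bracket_zero_subgroup: assumes "x \<in> hv_algebra {0}" "y \<in> hv_algebra {0}" shows "bracket x y = (0::'a::field hv)"
proof -
  have "bracket_index u v = 0" if "u \<in> Poly_Mapping.keys x" "v \<in> Poly_Mapping.keys y" for u v
    using hv_algebra_zero_cases[OF assms(1) that(1)] hv_algebra_zero_cases[OF assms(2) that(2)] by auto
  then show ?thesis by (simp add: bracket_def lift_def)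
qed

definition H_to_L :: "'a::field hv \<Rightarrow> 'a hv" where
  "H_to_L = hv_extend {0} (\<lambda>u. case u of LI \<alpha> i \<Rightarrow> 0 | HI \<alpha> i \<Rightarrow> L_basis 0 i)"

lemma H_to_L_in_Der: "H_to_L \<in> Der {0::'a::field}"
proof -
  have "lift (\<lambda>u. case u of LI \<alpha> i \<Rightarrow> 0 | HI \<alpha> i \<Rightarrow> (L_basis 0 i :: 'a hv)) x \<in> hv_algebra {0}" for x
    unfolding lift_def
    by (intro hv_sum hv_scale) (auto simp: hv_algebra_def L_basis_def split: hv_index.split)
  moreover have "0 \<in> hv_algebra {0::'a}" by (simp add: hv_algebra_def)
  ultimately show ?thesis
    by (auto simp: Der_def endos_def H_to_L_def hv_extend_def hv_add hv_scale lift_add lift_scale bracket_zero_subgroup)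
       (simp add: lift_def)
qed

lemma lookup_H_laurent_LI: "Poly_Mapping.lookup (H_laurent a p) (LI b i) = 0"
  by (simp add: H_laurent_def lift_def lookup_sum H_basis_def lookup_single)

lemma Der_zero_subgroup: "Der {0::'a::field} \<noteq> inner_ders {0} + (Ders_hom {0} + Ders_g {0} + Ders_mult {0} + Ders_loop {0})"
proof
  assume eq: "Der {0::'a} = inner_ders {0} + (Ders_hom {0} + Ders_g {0} + Ders_mult {0} + Ders_loop {0})"
  let ?h = "H_basis (0::'a) 0" and ?k = "LI (0::'a) 0"
  have h: "?h \<in> hv_algebra {0}" by (simp add: hv_algebra_def H_basis_def)
  have a: "Poly_Mapping.lookup (D ?h) ?k = 0" if "D \<in> inner_ders {0}" for D
    using that by (auto simp: inner_ders_def ad_def h bracket_zero_subgroup)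
  have b: "Poly_Mapping.lookup (D ?h) ?k = 0" if "D \<in> Ders_hom {0} \<or> D \<in> Ders_g {0} \<or> D \<in> Ders_mult {0} \<or> D \<in> Ders_loop {0}" for D
    using that by (auto simp: Ders_hom_def Ders_g_def Ders_mult_def Ders_loop_def D_hom_def D_g_def D_mult_def D_loop_def hv_extend_def h; 
      simp add: H_basis_def laurent_act_def lookup_H_laurent_LI)
  have "H_to_L \<in> inner_ders {0} + (Ders_hom {0} + Ders_g {0} + Ders_mult {0} + Ders_loop {0::'a})"
    using H_to_L_in_Der eq by blast
  then obtain d0 d1 d2 d3 d4 where c: "H_to_L = d0 + (d1 + d2 + d3 + d4)" "d0 \<in> inner_ders {0}" "d1 \<in> Ders_hom {0}"
     "d2 \<in> Ders_g {0}" "d3 \<in> Ders_mult {0}" "d4 \<in> Ders_loop {0::'a}"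
    by (elim set_plus_elim) blast
  have "Poly_Mapping.lookup ((d0 + (d1 + d2 + d3 + d4)) ?h) ?k = 0"
    using a[OF c(2)] b[of d1] b[of d2] b[of d3] b[of d4] c(3-) by (simp add: lookup_add)
  then have "Poly_Mapping.lookup (H_to_L ?h) ?k = 0" by (simp only: c(1))
  then show False by (simp add: H_to_L_def hv_extend_def h) (simp add: H_basis_def L_basis_def)
qed

end

theory Submission
  imports Defs
begin

text \<open>
  The algebra is graded by \<open>\<Gamma>\<close>, and the grading is the eigenspace decomposition of the single
  element \<open>L_basis 0 0\<close>: bracketing \<open>x\<close> with it multiplies the component of degree \<open>\<gamma>\<close> by \<open>\<gamma>\<close>.
  This lets one inner derivation do all the work, even when \<open>\<Gamma>\<close> is not finitely generated.
  Given a derivation \<open>D\<close>, the vector \<open>D (L_basis 0 0)\<close> has only finitely many components, and those of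
  nonzero degree \<open>\<gamma>\<close> can be divided by \<open>\<gamma>\<close>; the resulting \<open>y\<close> makes \<open>D - ad \<Gamma> y\<close> send \<open>L_basis 0 0\<close>
  into degree zero. A derivation with this property preserves the degree (\<open>Der_homogeneous\<close>): applied to
  the eigenvector equation of a basis vector of degree \<open>\<beta>\<close>, it shows that a component of the image in
  degree \<open>\<gamma>\<close> is multiplied both by \<open>\<beta>\<close> and by \<open>\<gamma>\<close>.

  Each homogeneous component is a free module of rank two over the Laurent polynomials. Hence an
  endomorphism that preserves the degree amounts to a family of \<open>2 \<times> 2\<close> matrices of Laurent
  polynomials indexed by \<open>\<Gamma> \<times> \<int>\<close> (\<open>homogeneous_endo_is_twist\<close>), and it is a derivation if and only if
  the entries satisfy a system of functional equations (\<open>twist_Der_iff\<close>). The system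
  is solved in \<open>twist_cocycle_solution\<close>: the entry from \<open>H\<close> to \<open>L\<close> vanishes; the entry from
  \<open>L\<close> to \<open>L\<close> is additive on \<open>\<Gamma> \<times> \<int>\<close>, so it splits into a homomorphism on \<open>\<Gamma>\<close> and a
  part linear in the exponent, which comes from \<open>ddt\<close>; the entry from \<open>L\<close> to \<open>H\<close> depends on the
  degree alone and lies in \<open>g_space \<Gamma>\<close>; and the two diagonal entries differ by a constant.
  These are the four outer families.

  The same matrices show that the outer maps are derivations, because their entries satisfy the
  system, and that their sum is direct, because the entries at exponents \<open>0\<close> and \<open>1\<close> determine each
  summand.
\<close>

section \<open>Laurent coefficients and homogeneous elements\<close>

lemma linear_eq_on_keys:
  assumes f: "Vector_Spaces.linear scale scale f" and g: "Vector_Spaces.linear scale scale g"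
    and eq: "\<And>k. k \<in> Poly_Mapping.keys x \<Longrightarrow> f (Poly_Mapping.single k 1) = g (Poly_Mapping.single k 1)"
  shows "f x = g x"
proof -
  interpret f: Vector_Spaces.linear scale scale f by fact
  interpret g: Vector_Spaces.linear scale scale g by fact
  show ?thesis
    by (subst (1 2) pm_sum_basis) (simp add: f.sum g.sum f.scale g.scale eq)
qed

lemma tpow_mult_neg [simp]: "p * tpow i * tpow (- i) = (p :: 'a::field laurent)"
  "p * tpow (- i) * tpow i = p"
  by (simp_all add: mult.assoc tpow_0 flip: tpow_add)

lemma tpow_nonzero [simp]: "tpow i \<noteq> (0 :: 'a::field laurent)"
  unfolding tpow_def by (metis lookup_single_eq lookup_zero one_neq_zero)

lemma lookup_laurent [simp]:
  "Poly_Mapping.lookup (L_laurent \<alpha> p) (LI \<beta> i) = (if \<beta> = \<alpha> then Poly_Mapping.lookup p i else 0)"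
  "Poly_Mapping.lookup (L_laurent \<alpha> p) (HI \<beta> i) = 0"
  "Poly_Mapping.lookup (H_laurent \<alpha> p) (HI \<beta> i) = (if \<beta> = \<alpha> then Poly_Mapping.lookup p i else 0)"
  "Poly_Mapping.lookup (H_laurent \<alpha> p) (LI \<beta> i) = 0"
  by (auto simp: L_laurent_def H_laurent_def lift_def lookup_sum L_basis_def H_basis_def
      lookup_single when_def in_keys_iff if_distrib cong: if_cong)

lemma laurent_linear:
  "L_laurent \<alpha> (p + q) = L_laurent \<alpha> p + L_laurent \<alpha> q"
  "H_laurent \<alpha> (p + q) = H_laurent \<alpha> p + H_laurent \<alpha> q"
  "L_laurent \<alpha> (scale c p) = scale c (L_laurent \<alpha> p)"
  "H_laurent \<alpha> (scale c p) = scale c (H_laurent \<alpha> p)"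
  "L_laurent \<alpha> 0 = 0" "H_laurent \<alpha> 0 = 0"
  unfolding L_laurent_def H_laurent_def by (simp_all add: lift_add lift_scale) (simp_all add: lift_def)

lemma basis_eq_laurent:
  "L_basis \<alpha> i = L_laurent \<alpha> (tpow i)" "H_basis \<alpha> i = H_laurent \<alpha> (tpow i)"
  by (simp_all add: L_laurent_def H_laurent_def tpow_def)

lemma bilinear_eqI:
  assumes "\<And>q. Vector_Spaces.linear scale scale (\<lambda>p. f p q)" "\<And>p. Vector_Spaces.linear scale scale (f p)"
    and "\<And>q. Vector_Spaces.linear scale scale (\<lambda>p. g p q)" "\<And>p. Vector_Spaces.linear scale scale (g p)"
    and "\<And>u v. f (Poly_Mapping.single u 1) (Poly_Mapping.single v 1) = g (Poly_Mapping.single u 1) (Poly_Mapping.single v 1)"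
  shows "f p q = g p q"
proof -
  have "f (Poly_Mapping.single u 1) q = g (Poly_Mapping.single u 1) q" for u q
    using pm_linear_eqI[OF assms(2,4)] assms(5) by blast
  then show ?thesis using pm_linear_eqI[OF assms(1,3)] by blast
qed

lemma bracket_laurent:
  "bracket (L_laurent \<alpha> p) (L_laurent \<beta> q) = scale (\<alpha> - \<beta>) (L_laurent (\<alpha> + \<beta>) (p * q))"
  "bracket (L_laurent \<alpha> p) (H_laurent \<beta> q) = scale (- \<beta>) (H_laurent (\<alpha> + \<beta>) (p * q))"
  "bracket (H_laurent \<alpha> p) (L_laurent \<beta> q) = scale \<alpha> (H_laurent (\<alpha> + \<beta>) (p * q))"
  "bracket (H_laurent \<alpha> p) (H_laurent \<beta> q) = 0"
  by (rule bilinear_eqI[where p = p and q = q],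
      (rule pm_linearI; simp add: laurent_linear bracket_simps distrib_left distrib_right
        scale_mult_left scale_mult_right pm.scale_right_distrib mult.commute del: pm.scale_minus_left)+,
      simp add: bracket_basis flip: tpow_def tpow_add basis_eq_laurent)+

fun degree_of :: "'a hv_index \<Rightarrow> 'a" where
  "degree_of (LI \<alpha> i) = \<alpha>"
| "degree_of (HI \<alpha> i) = \<alpha>"

lemma hv_algebra_iff: "x \<in> hv_algebra \<Gamma> \<longleftrightarrow> (\<forall>u\<in>Poly_Mapping.keys x. degree_of u \<in> \<Gamma>)"
proof -
  have "u \<in> {LI \<alpha> i | \<alpha> i. \<alpha> \<in> \<Gamma>} \<union> {HI \<alpha> i | \<alpha> i. \<alpha> \<in> \<Gamma>} \<longleftrightarrow> degree_of u \<in> \<Gamma>" for u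
    by (cases u) auto
  then show ?thesis unfolding hv_algebra_def by blast
qed

lemma laurent_in_hv_algebra:
  assumes "\<alpha> \<in> \<Gamma>"
  shows "L_laurent \<alpha> p \<in> hv_algebra \<Gamma>" "H_laurent \<alpha> p \<in> hv_algebra \<Gamma>"
proof -
  have "degree_of u = \<alpha>" if "u \<in> Poly_Mapping.keys (L_laurent \<alpha> p)" for u
    using that by (cases u) (auto simp: in_keys_iff split: if_splits)
  moreover have "degree_of u = \<alpha>" if "u \<in> Poly_Mapping.keys (H_laurent \<alpha> p)" for u
    using that by (cases u) (auto simp: in_keys_iff split: if_splits)
  ultimately show "L_laurent \<alpha> p \<in> hv_algebra \<Gamma>" "H_laurent \<alpha> p \<in> hv_algebra \<Gamma>"
    using assms by (auto simp: hv_algebra_iff)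
qed

lemma single_in_hv_algebra: "degree_of u \<in> \<Gamma> \<Longrightarrow> Poly_Mapping.single u 1 \<in> hv_algebra \<Gamma>"
  by (simp add: hv_algebra_iff)

definition homogeneous :: "'a::field \<Rightarrow> 'a hv \<Rightarrow> bool" where
  "homogeneous \<alpha> x \<longleftrightarrow> (\<forall>u. degree_of u \<noteq> \<alpha> \<longrightarrow> Poly_Mapping.lookup x u = 0)"

definition L_coeff :: "'a::field \<Rightarrow> 'a hv \<Rightarrow> 'a laurent" where
  "L_coeff \<alpha> x = lift (\<lambda>u. case u of LI \<beta> i \<Rightarrow> (if \<beta> = \<alpha> then tpow i else 0) | HI \<beta> i \<Rightarrow> 0) x"

definition H_coeff :: "'a::field \<Rightarrow> 'a hv \<Rightarrow> 'a laurent" where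
  "H_coeff \<alpha> x = lift (\<lambda>u. case u of HI \<beta> i \<Rightarrow> (if \<beta> = \<alpha> then tpow i else 0) | LI \<beta> i \<Rightarrow> 0) x"

lemma lookup_coeff [simp]:
  "Poly_Mapping.lookup (L_coeff \<alpha> x) i = Poly_Mapping.lookup x (LI \<alpha> i)"
  "Poly_Mapping.lookup (H_coeff \<alpha> x) i = Poly_Mapping.lookup x (HI \<alpha> i)"
proof -
  have "Poly_Mapping.lookup (L_coeff \<alpha> x) i
      = (\<Sum>u\<in>Poly_Mapping.keys x. if u = LI \<alpha> i then Poly_Mapping.lookup x u else 0)"
    unfolding L_coeff_def lift_def lookup_sum
    by (rule sum.cong) (auto simp: tpow_def lookup_single when_def split: hv_index.splits)
  then show "Poly_Mapping.lookup (L_coeff \<alpha> x) i = Poly_Mapping.lookup x (LI \<alpha> i)"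
    by (simp add: in_keys_iff)
  have "Poly_Mapping.lookup (H_coeff \<alpha> x) i
      = (\<Sum>u\<in>Poly_Mapping.keys x. if u = HI \<alpha> i then Poly_Mapping.lookup x u else 0)"
    unfolding H_coeff_def lift_def lookup_sum
    by (rule sum.cong) (auto simp: tpow_def lookup_single when_def split: hv_index.splits)
  then show "Poly_Mapping.lookup (H_coeff \<alpha> x) i = Poly_Mapping.lookup x (HI \<alpha> i)"
    by (simp add: in_keys_iff)
qed

lemma homogeneous_decomp:
  assumes "homogeneous \<alpha> x"
  shows "x = L_laurent \<alpha> (L_coeff \<alpha> x) + H_laurent \<alpha> (H_coeff \<alpha> x)"
proof (rule poly_mapping_eqI)
  fix u show "Poly_Mapping.lookup x u = Poly_Mapping.lookup (L_laurent \<alpha> (L_coeff \<alpha> x) + H_laurent \<alpha> (H_coeff \<alpha> x)) u"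
    using assms by (cases u) (auto simp: lookup_add homogeneous_def)
qed

lemma homogeneous_laurent: "homogeneous \<alpha> (L_laurent \<alpha> p)" "homogeneous \<alpha> (H_laurent \<alpha> p)"
proof -
  have "Poly_Mapping.lookup (L_laurent \<alpha> p) u = 0" "Poly_Mapping.lookup (H_laurent \<alpha> p) u = 0"
    if "degree_of u \<noteq> \<alpha>" for u using that by (cases u; simp)+
  then show "homogeneous \<alpha> (L_laurent \<alpha> p)" "homogeneous \<alpha> (H_laurent \<alpha> p)" by (auto simp: homogeneous_def)
qed

lemma homogeneous_linear:
  "homogeneous \<alpha> x \<Longrightarrow> homogeneous \<alpha> y \<Longrightarrow> homogeneous \<alpha> (x + y)"
  "homogeneous \<alpha> x \<Longrightarrow> homogeneous \<alpha> (scale c x)" "homogeneous \<alpha> 0"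
  by (auto simp: homogeneous_def lookup_add)

text \<open>
  The grading is additive under the bracket; this is what confines the error term in
  \<open>Der_homogeneous\<close> to a single degree.
\<close>

lemma homogeneous_bracket:
  assumes "homogeneous \<alpha> x" "homogeneous \<beta> y"
  shows "homogeneous (\<alpha> + \<beta>) (bracket x y)"
  by (subst homogeneous_decomp[OF assms(1)], subst homogeneous_decomp[OF assms(2)])
     (simp add: bracket_simps bracket_laurent homogeneous_linear homogeneous_laurent
       del: pm.scale_minus_left)

lemma homogeneous_single: "homogeneous (degree_of u) (Poly_Mapping.single u c)"
  by (auto simp: homogeneous_def lookup_single when_def)

lemma laurent_pair_eq_iff:
  "L_laurent \<alpha> p + H_laurent \<alpha> q = L_laurent \<alpha> p' + H_laurent \<alpha> q' \<longleftrightarrow> p = p' \<and> q = q'" (is "?l = ?r")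
proof
  assume l: ?l
  have "Poly_Mapping.lookup p i = Poly_Mapping.lookup p' i" "Poly_Mapping.lookup q i = Poly_Mapping.lookup q' i" for i
    using arg_cong[OF l, of "\<lambda>x. Poly_Mapping.lookup x (LI \<alpha> i)"]
      arg_cong[OF l, of "\<lambda>x. Poly_Mapping.lookup x (HI \<alpha> i)"] by (simp_all add: lookup_add)
  then show ?r by (simp add: poly_mapping_eqI)
qed simp


section \<open>Endomorphisms and derivations on basis vectors\<close>

lemma lift_in_hv_algebra:
  assumes "\<And>u. degree_of u \<in> \<Gamma> \<Longrightarrow> f u \<in> hv_algebra \<Gamma>" "x \<in> hv_algebra \<Gamma>"
  shows "lift f x \<in> hv_algebra \<Gamma>"
  unfolding lift_def using assms by (intro hv_sum hv_scale) (auto simp: hv_algebra_iff)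

lemma hv_extend_in_endos:
  assumes "\<And>u. degree_of u \<in> \<Gamma> \<Longrightarrow> f u \<in> hv_algebra \<Gamma>"
  shows "hv_extend \<Gamma> f \<in> endos \<Gamma>"
  using lift_in_hv_algebra[of \<Gamma> f, OF assms]
  by (auto simp: endos_def hv_extend_def hv_add hv_scale lift_add lift_scale)

lemma hv_extend_single:
  "degree_of u \<in> \<Gamma> \<Longrightarrow> hv_extend \<Gamma> f (Poly_Mapping.single u 1) = f u"
  by (simp add: hv_extend_def single_in_hv_algebra)

lemma hv_extend_cong:
  assumes "\<And>u. degree_of u \<in> \<Gamma> \<Longrightarrow> f u = g u"
  shows "hv_extend \<Gamma> f = hv_extend \<Gamma> g"
  using assms by (auto simp: hv_extend_def lift_def hv_algebra_iff fun_eq_iff intro!: sum.cong)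

text \<open>
  An endomorphism is linear on \<open>hv_algebra \<Gamma>\<close> only, so the values on basis vectors have to be
  extended along the finite sum that represents a vector, with all partial sums kept inside the algebra.
\<close>

lemma endos_eq_hv_extend:
  assumes "D \<in> endos \<Gamma>"
  shows "D = hv_extend \<Gamma> (\<lambda>u. D (Poly_Mapping.single u 1))"
proof
  fix x
  show "D x = hv_extend \<Gamma> (\<lambda>u. D (Poly_Mapping.single u 1)) x"
  proof (cases "x \<in> hv_algebra \<Gamma>")
    case True
    let ?t = "\<lambda>u. scale (Poly_Mapping.lookup x u) (Poly_Mapping.single u 1)"
    have zero: "0 \<in> hv_algebra \<Gamma>" by (simp add: hv_algebra_iff)
    have "D (0 + 0) = D 0 + D 0" using assms zero unfolding endos_def by blast
    then have D0: "D 0 = 0" by simp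
    have t: "?t u \<in> hv_algebra \<Gamma>" if "u \<in> Poly_Mapping.keys x" for u
      using that True by (intro hv_scale single_in_hv_algebra) (auto simp: hv_algebra_iff)
    have "D (sum ?t A) = (\<Sum>u\<in>A. scale (Poly_Mapping.lookup x u) (D (Poly_Mapping.single u 1)))"
      if "finite A" "A \<subseteq> Poly_Mapping.keys x" for A
      using that
    proof (induction A)
      case (insert u A)
      have u: "Poly_Mapping.single u 1 \<in> hv_algebra \<Gamma>"
        using insert.prems True by (auto simp: hv_algebra_iff)
      have s: "sum ?t A \<in> hv_algebra \<Gamma>" using insert.prems t by (intro hv_sum) auto
      have "D (?t u + sum ?t A) = D (?t u) + D (sum ?t A)"
        using assms hv_scale[OF u] s unfolding endos_def by blast
      also have "D (?t u) = scale (Poly_Mapping.lookup x u) (D (Poly_Mapping.single u 1))"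
        using assms u unfolding endos_def by blast
      finally show ?case using insert by simp
    qed (simp add: D0)
    then have "D (sum ?t (Poly_Mapping.keys x)) = lift (\<lambda>u. D (Poly_Mapping.single u 1)) x"
      by (simp add: lift_def)
    then show ?thesis using True by (simp add: hv_extend_def flip: pm_sum_basis)
  qed (use assms in \<open>auto simp: hv_extend_def endos_def\<close>)
qed

text \<open>
  Both sides of the Leibniz rule are bilinear, so it suffices to test it on pairs of basis vectors
  that occur in the algebra. The values of \<open>f\<close> at other indices are arbitrary, whence the comparison on
  supports (\<open>linear_eq_on_keys\<close>).
\<close>

lemma hv_extend_Der_iff:
  assumes \<Gamma>: "add_subgroup \<Gamma>" and f: "\<And>u. degree_of u \<in> \<Gamma> \<Longrightarrow> f u \<in> hv_algebra \<Gamma>"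
  shows "hv_extend \<Gamma> f \<in> Der \<Gamma> \<longleftrightarrow> (\<forall>u v. degree_of u \<in> \<Gamma> \<longrightarrow> degree_of v \<in> \<Gamma> \<longrightarrow>
     lift f (bracket_index u v) = bracket (f u) (Poly_Mapping.single v 1) + bracket (Poly_Mapping.single u 1) (f v))"
    (is "?l \<longleftrightarrow> ?r")
proof
  have bs: "bracket (Poly_Mapping.single u 1) (Poly_Mapping.single v 1) = bracket_index u v" for u v :: "'a hv_index"
    by (simp add: bracket_def)
  show ?r if ?l
  proof (intro allI impI)
    fix u v assume u: "degree_of u \<in> \<Gamma>" and v: "degree_of v \<in> \<Gamma>"
    let ?u = "Poly_Mapping.single u (1::'a)" and ?v = "Poly_Mapping.single v (1::'a)"
    have uv: "?u \<in> hv_algebra \<Gamma>" "?v \<in> hv_algebra \<Gamma>" using u v by (auto intro: single_in_hv_algebra)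
    then have "hv_extend \<Gamma> f (bracket ?u ?v) = bracket (hv_extend \<Gamma> f ?u) ?v + bracket ?u (hv_extend \<Gamma> f ?v)"
      using that unfolding Der_def by blast
    moreover have "bracket ?u ?v \<in> hv_algebra \<Gamma>" by (rule hv_algebra_closed[OF \<Gamma> uv])
    ultimately show "lift f (bracket_index u v) = bracket (f u) ?v + bracket ?u (f v)"
      by (simp add: hv_extend_single u v) (simp add: hv_extend_def bs)
  qed
  show ?l if r: ?r
  proof -
    have "lift f (bracket x y) = bracket (lift f x) y + bracket x (lift f y)"
      if x: "x \<in> hv_algebra \<Gamma>" and y: "y \<in> hv_algebra \<Gamma>" for x y
    proof (rule linear_eq_on_keys[where x = x])
      fix u assume "u \<in> Poly_Mapping.keys x"
      then have u: "degree_of u \<in> \<Gamma>" using x by (auto simp: hv_algebra_iff)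
      let ?u = "Poly_Mapping.single u (1::'a)"
      show "lift f (bracket ?u y) = bracket (lift f ?u) y + bracket ?u (lift f y)"
      proof (rule linear_eq_on_keys[where x = y])
        fix v assume "v \<in> Poly_Mapping.keys y"
        then have v: "degree_of v \<in> \<Gamma>" using y by (auto simp: hv_algebra_iff)
        show "lift f (bracket ?u (Poly_Mapping.single v 1))
            = bracket (lift f ?u) (Poly_Mapping.single v 1) + bracket ?u (lift f (Poly_Mapping.single v 1))"
          using r u v by (simp add: bs)
      qed (rule pm_linearI; simp add: lift_add lift_scale bracket_simps pm.scale_right_distrib algebra_simps)+
    qed (rule pm_linearI; simp add: lift_add lift_scale bracket_simps pm.scale_right_distrib algebra_simps)+
    then show ?l
      using hv_extend_in_endos[of \<Gamma> f, OF f] hv_algebra_closed[OF \<Gamma>]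
      by (auto simp: Der_def) (simp add: hv_extend_def)
  qed
qed

lemma Der_add:
  assumes "add_subgroup \<Gamma>" "D \<in> Der \<Gamma>" "E \<in> Der \<Gamma>"
  shows "D + E \<in> Der \<Gamma>"
  using assms hv_algebra_closed[OF assms(1)]
  by (auto simp: Der_def endos_def hv_add pm.scale_right_distrib bracket_simps)

lemma ad_in_Der:
  assumes "add_subgroup \<Gamma>" "x \<in> hv_algebra \<Gamma>"
  shows "ad \<Gamma> x \<in> Der \<Gamma>"
proof -
  have "bracket x (bracket y z) = bracket (bracket x y) z + bracket y (bracket x z)" for y z
    using jacobi[of x y z] bracket_anti[of z "bracket x y"] bracket_anti[of z x]
    by (simp add: bracket_simps algebra_simps)
  then show ?thesis
    using assms(2) hv_algebra_closed[OF assms(1)]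
    by (auto simp: Der_def endos_def ad_def hv_add hv_scale bracket_simps)
qed


section \<open>Degree-zero derivations as matrices\<close>

text \<open>
  The matrix at \<open>(\<alpha>, i)\<close> has the rows \<open>(a, b)\<close> and \<open>(c, d)\<close>, giving the \<open>L\<close> and \<open>H\<close> coordinates of the
  images of \<open>L_basis \<alpha> i\<close> and \<open>H_basis \<alpha> i\<close>. The factor \<open>tpow i\<close> is split off so that maps which are linear
  over the Laurent polynomials are those with entries independent of \<open>i\<close>.
\<close>

definition twist :: "'a::field set \<Rightarrow> ('a \<Rightarrow> int \<Rightarrow> 'a laurent) \<Rightarrow> ('a \<Rightarrow> int \<Rightarrow> 'a laurent) \<Rightarrow>
    ('a \<Rightarrow> int \<Rightarrow> 'a laurent) \<Rightarrow> ('a \<Rightarrow> int \<Rightarrow> 'a laurent) \<Rightarrow> 'a hv \<Rightarrow> 'a hv" where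
  "twist \<Gamma> a b c d = hv_extend \<Gamma> (\<lambda>u. case u of
      LI \<alpha> i \<Rightarrow> L_laurent \<alpha> (a \<alpha> i * tpow i) + H_laurent \<alpha> (b \<alpha> i * tpow i)
    | HI \<alpha> i \<Rightarrow> L_laurent \<alpha> (c \<alpha> i * tpow i) + H_laurent \<alpha> (d \<alpha> i * tpow i))"

text \<open>
  The Leibniz rule in coordinates: two equations from a pair \<open>L, L\<close>, two from a pair \<open>L, H\<close> and one
  from a pair \<open>H, H\<close>.
\<close>

definition twist_cocycle :: "'a::field set \<Rightarrow> ('a \<Rightarrow> int \<Rightarrow> 'a laurent) \<Rightarrow> ('a \<Rightarrow> int \<Rightarrow> 'a laurent) \<Rightarrow>
    ('a \<Rightarrow> int \<Rightarrow> 'a laurent) \<Rightarrow> ('a \<Rightarrow> int \<Rightarrow> 'a laurent) \<Rightarrow> bool" where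
  "twist_cocycle \<Gamma> a b c d \<longleftrightarrow> (\<forall>\<alpha>\<in>\<Gamma>. \<forall>\<beta>\<in>\<Gamma>. \<forall>i j.
     scale (\<alpha> - \<beta>) (a (\<alpha> + \<beta>) (i + j)) = scale (\<alpha> - \<beta>) (a \<alpha> i + a \<beta> j) \<and>
     scale (\<alpha> - \<beta>) (b (\<alpha> + \<beta>) (i + j)) = scale \<alpha> (b \<alpha> i) - scale \<beta> (b \<beta> j) \<and>
     scale (- \<beta>) (c (\<alpha> + \<beta>) (i + j)) = scale (\<alpha> - \<beta>) (c \<beta> j) \<and>
     scale \<beta> (d (\<alpha> + \<beta>) (i + j)) = scale \<beta> (a \<alpha> i + d \<beta> j) \<and>
     scale \<alpha> (c \<beta> j) = scale \<beta> (c \<alpha> i))"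

text \<open>
  Pairs of basis vectors suffice. On a pair with exponents \<open>i\<close> and \<open>j\<close> every term of the Leibniz rule
  carries the factor \<open>tpow (i + j)\<close>, which cancels. A pair \<open>H, L\<close> gives nothing beyond the pair
  \<open>L, H\<close>, by antisymmetry.
\<close>

lemma twist_Der_iff:
  assumes "add_subgroup \<Gamma>"
  shows "twist \<Gamma> a b c d \<in> Der \<Gamma> \<longleftrightarrow> twist_cocycle \<Gamma> a b c d"
proof -
  define f where "f u = (case u of
      LI \<alpha> i \<Rightarrow> L_laurent \<alpha> (a \<alpha> i * tpow i) + H_laurent \<alpha> (b \<alpha> i * tpow i)
    | HI \<alpha> i \<Rightarrow> L_laurent \<alpha> (c \<alpha> i * tpow i) + H_laurent \<alpha> (d \<alpha> i * tpow i))" for u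
  let ?P = "\<lambda>u v. lift f (bracket_index u v) = bracket (f u) (Poly_Mapping.single v 1) + bracket (Poly_Mapping.single u 1) (f v)"
  have f: "f u \<in> hv_algebra \<Gamma>" if "degree_of u \<in> \<Gamma>" for u
    using that by (cases u) (auto simp: f_def intro!: hv_add laurent_in_hv_algebra)
  have single: "Poly_Mapping.single (LI \<alpha> i) 1 = L_laurent \<alpha> (tpow i)"
     "Poly_Mapping.single (HI \<alpha> i) 1 = H_laurent \<alpha> (tpow i)" for \<alpha> :: 'a and i
    by (simp_all add: L_laurent_def H_laurent_def tpow_def L_basis_def H_basis_def)
  have lift_basis: "lift f (L_basis \<alpha> i) = f (LI \<alpha> i)" "lift f (H_basis \<alpha> i) = f (HI \<alpha> i)" for \<alpha> i
    by (simp_all add: L_basis_def H_basis_def)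
  have zero: "lift f 0 = 0" by (simp add: lift_def)
  \<comment> \<open>rules that bring both sides to the form \<open>L_laurent \<gamma> (p * tpow n) + H_laurent \<gamma> (q * tpow n)\<close>\<close>
  have collect: "p * tpow i * tpow j = p * tpow (i + j)" "tpow i * (p * tpow j) = p * tpow (i + j)"
    for p :: "'a laurent" and i j by (simp_all add: tpow_add ac_simps)
  have form: "scale k (L_laurent \<gamma> (p * tpow n)) = L_laurent \<gamma> (scale k p * tpow n)"
    "scale k (H_laurent \<gamma> (p * tpow n)) = H_laurent \<gamma> (scale k p * tpow n)" for k \<gamma> p n
    by (simp_all add: laurent_linear scale_mult_left)
  have shapes: "L_laurent \<gamma> (p * tpow n) + L_laurent \<gamma> (q * tpow n) = L_laurent \<gamma> ((p + q) * tpow n)"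
    "H_laurent \<gamma> (p * tpow n) + H_laurent \<gamma> (q * tpow n) = H_laurent \<gamma> ((p + q) * tpow n)" for \<gamma> p q n
    by (simp_all add: laurent_linear distrib_right)
  have LL: "?P (LI \<alpha> i) (LI \<beta> j) \<longleftrightarrow>
      scale (\<alpha> - \<beta>) (a (\<alpha> + \<beta>) (i + j)) = scale (\<alpha> - \<beta>) (a \<alpha> i + a \<beta> j) \<and>
      scale (\<alpha> - \<beta>) (b (\<alpha> + \<beta>) (i + j)) = scale \<alpha> (b \<alpha> i) - scale \<beta> (b \<beta> j)" for \<alpha> \<beta> i j
  proof -
    have "lift f (bracket_index (LI \<alpha> i) (LI \<beta> j))
       = L_laurent (\<alpha> + \<beta>) (scale (\<alpha> - \<beta>) (a (\<alpha> + \<beta>) (i + j)) * tpow (i + j))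
       + H_laurent (\<alpha> + \<beta>) (scale (\<alpha> - \<beta>) (b (\<alpha> + \<beta>) (i + j)) * tpow (i + j))"
      by (simp add: lift_scale lift_basis) (simp add: f_def pm.scale_right_distrib form)
    moreover have "bracket (f (LI \<alpha> i)) (Poly_Mapping.single (LI \<beta> j) 1) + bracket (Poly_Mapping.single (LI \<alpha> i) 1) (f (LI \<beta> j))
       = L_laurent (\<alpha> + \<beta>) ((scale (\<alpha> - \<beta>) (a \<alpha> i) + scale (\<alpha> - \<beta>) (a \<beta> j)) * tpow (i + j))
       + H_laurent (\<alpha> + \<beta>) ((scale \<alpha> (b \<alpha> i) + scale (- \<beta>) (b \<beta> j)) * tpow (i + j))"
      by (simp only: f_def hv_index.case single bracket_simps bracket_laurent collect form
          laurent_linear(1,2) distrib_right add.assoc add.commute add.left_commute)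
    ultimately show ?thesis by (simp add: laurent_pair_eq_iff pm.scale_right_distrib)
  qed
  have LH: "?P (LI \<alpha> i) (HI \<beta> j) \<longleftrightarrow>
      scale (- \<beta>) (c (\<alpha> + \<beta>) (i + j)) = scale (\<alpha> - \<beta>) (c \<beta> j) \<and>
      scale \<beta> (d (\<alpha> + \<beta>) (i + j)) = scale \<beta> (a \<alpha> i + d \<beta> j)" for \<alpha> \<beta> i j
  proof -
    have "lift f (bracket_index (LI \<alpha> i) (HI \<beta> j))
       = L_laurent (\<alpha> + \<beta>) (scale (- \<beta>) (c (\<alpha> + \<beta>) (i + j)) * tpow (i + j))
       + H_laurent (\<alpha> + \<beta>) (scale (- \<beta>) (d (\<alpha> + \<beta>) (i + j)) * tpow (i + j))"
      by (simp add: lift_scale lift_basis del: pm.scale_minus_left)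
         (simp add: f_def pm.scale_right_distrib form del: pm.scale_minus_left)
    moreover have "bracket (f (LI \<alpha> i)) (Poly_Mapping.single (HI \<beta> j) 1) + bracket (Poly_Mapping.single (LI \<alpha> i) 1) (f (HI \<beta> j))
       = L_laurent (\<alpha> + \<beta>) (scale (\<alpha> - \<beta>) (c \<beta> j) * tpow (i + j))
       + H_laurent (\<alpha> + \<beta>) ((scale (- \<beta>) (a \<alpha> i) + scale (- \<beta>) (d \<beta> j)) * tpow (i + j))"
      by (simp only: f_def hv_index.case single bracket_simps bracket_laurent collect form
          laurent_linear(1,2) distrib_right add_0_right add_0_left add.assoc add.commute add.left_commute)
    moreover have "scale (- \<beta>) x = scale (- \<beta>) y \<longleftrightarrow> scale \<beta> x = scale \<beta> y" for x y :: "'a laurent"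
      by simp
    ultimately show ?thesis
      by (simp only: laurent_pair_eq_iff mult_cancel_right tpow_nonzero simp_thms flip: pm.scale_right_distrib)
  qed
  have HL: "?P (HI \<alpha> i) (LI \<beta> j) \<longleftrightarrow> ?P (LI \<beta> j) (HI \<alpha> i)" for \<alpha> \<beta> i j
  proof -
    have "bracket_index (HI \<alpha> i) (LI \<beta> j) = - bracket_index (LI \<beta> j) (HI \<alpha> i)"
      by (simp add: add.commute)
    moreover have "lift f (- x) = - lift f x" for x
      using lift_scale[of f "-1" x] by simp
    ultimately have "lift f (bracket_index (HI \<alpha> i) (LI \<beta> j)) = - lift f (bracket_index (LI \<beta> j) (HI \<alpha> i))"
      by (simp only:)
    moreover have "bracket (f (HI \<alpha> i)) (Poly_Mapping.single (LI \<beta> j) 1) + bracket (Poly_Mapping.single (HI \<alpha> i) 1) (f (LI \<beta> j))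
      = - (bracket (f (LI \<beta> j)) (Poly_Mapping.single (HI \<alpha> i) 1) + bracket (Poly_Mapping.single (LI \<beta> j) 1) (f (HI \<alpha> i)))"
      by (subst (1 2) bracket_anti) simp
    ultimately show ?thesis by (simp only: neg_equal_iff_equal)
  qed
  have HH: "?P (HI \<alpha> i) (HI \<beta> j) \<longleftrightarrow> scale \<alpha> (c \<beta> j) = scale \<beta> (c \<alpha> i)" for \<alpha> \<beta> i j
  proof -
    have "bracket (f (HI \<alpha> i)) (Poly_Mapping.single (HI \<beta> j) 1) + bracket (Poly_Mapping.single (HI \<alpha> i) 1) (f (HI \<beta> j))
       = L_laurent (\<alpha> + \<beta>) (0 * tpow (i + j)) + H_laurent (\<alpha> + \<beta>) ((scale (- \<beta>) (c \<alpha> i) + scale \<alpha> (c \<beta> j)) * tpow (i + j))"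
      by (simp only: f_def hv_index.case single bracket_simps bracket_laurent collect form shapes
          add_0_right add_0_left mult_zero_left laurent_linear(5))
    moreover have "lift f (bracket_index (HI \<alpha> i) (HI \<beta> j))
       = L_laurent (\<alpha> + \<beta>) (0 * tpow (i + j)) + H_laurent (\<alpha> + \<beta>) (0 * tpow (i + j))"
      by (simp add: zero laurent_linear)
    ultimately have "?P (HI \<alpha> i) (HI \<beta> j) \<longleftrightarrow> 0 = scale (- \<beta>) (c \<alpha> i) + scale \<alpha> (c \<beta> j)"
      by (simp only: laurent_pair_eq_iff mult_cancel_right tpow_nonzero simp_thms)
    also have "\<dots> \<longleftrightarrow> scale \<alpha> (c \<beta> j) = scale \<beta> (c \<alpha> i)"
      unfolding pm.scale_minus_left uminus_add_conv_diff by (metis right_minus_eq)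
    finally show ?thesis .
  qed
  have "twist \<Gamma> a b c d = hv_extend \<Gamma> f"
    by (simp add: twist_def f_def[abs_def])
  then have "twist \<Gamma> a b c d \<in> Der \<Gamma> \<longleftrightarrow> (\<forall>u v. degree_of u \<in> \<Gamma> \<longrightarrow> degree_of v \<in> \<Gamma> \<longrightarrow> ?P u v)"
    using hv_extend_Der_iff[OF assms f] by simp
  also have "\<dots> \<longleftrightarrow> (\<forall>\<alpha>\<in>\<Gamma>. \<forall>\<beta>\<in>\<Gamma>. \<forall>i j. ?P (LI \<alpha> i) (LI \<beta> j) \<and> ?P (LI \<alpha> i) (HI \<beta> j) \<and> ?P (HI \<alpha> i) (HI \<beta> j))" (is "?A = ?B")
  proof
    assume ?A then show ?B by (simp del: bracket_index.simps)
  next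
    assume B: ?B show ?A
    proof (intro allI impI)
      fix u v assume "degree_of u \<in> \<Gamma>" "degree_of v \<in> \<Gamma>"
      with B show "?P u v" by (cases u; cases v) (simp_all add: HL del: bracket_index.simps)
    qed
  qed
  also have "\<dots> \<longleftrightarrow> twist_cocycle \<Gamma> a b c d"
    unfolding LL LH HH twist_cocycle_def conj_assoc ..
  finally show ?thesis .
qed

lemma twist_cong:
  assumes "\<And>\<alpha> i. \<alpha> \<in> \<Gamma> \<Longrightarrow> a \<alpha> i = a' \<alpha> i" "\<And>\<alpha> i. \<alpha> \<in> \<Gamma> \<Longrightarrow> b \<alpha> i = b' \<alpha> i"
    "\<And>\<alpha> i. \<alpha> \<in> \<Gamma> \<Longrightarrow> c \<alpha> i = c' \<alpha> i" "\<And>\<alpha> i. \<alpha> \<in> \<Gamma> \<Longrightarrow> d \<alpha> i = d' \<alpha> i"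
  shows "twist \<Gamma> a b c d = twist \<Gamma> a' b' c' d'"
  unfolding twist_def by (rule hv_extend_cong) (auto simp: assms split: hv_index.splits)

lemma twist_add:
  "twist \<Gamma> a b c d + twist \<Gamma> a' b' c' d' = twist \<Gamma> (\<lambda>\<alpha> i. a \<alpha> i + a' \<alpha> i) (\<lambda>\<alpha> i. b \<alpha> i + b' \<alpha> i)
     (\<lambda>\<alpha> i. c \<alpha> i + c' \<alpha> i) (\<lambda>\<alpha> i. d \<alpha> i + d' \<alpha> i)"
  by (auto simp: twist_def hv_extend_def fun_eq_iff laurent_linear distrib_right add_ac
      split: hv_index.splits intro!: arg_cong[where f = "\<lambda>f. lift f _"] simp flip: lift_fun_add)

lemma twist_scale:
  "scale_endo k (twist \<Gamma> a b c d) = twist \<Gamma> (\<lambda>\<alpha> i. scale k (a \<alpha> i)) (\<lambda>\<alpha> i. scale k (b \<alpha> i))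
     (\<lambda>\<alpha> i. scale k (c \<alpha> i)) (\<lambda>\<alpha> i. scale k (d \<alpha> i))"
  by (auto simp: twist_def hv_extend_def scale_endo_def fun_eq_iff laurent_linear scale_mult_left
      pm.scale_right_distrib
      split: hv_index.splits intro!: arg_cong[where f = "\<lambda>f. lift f _"] simp flip: lift_fun_scale)

lemma twist_eq_0_iff:
  "twist \<Gamma> a b c d = 0 \<longleftrightarrow> (\<forall>\<alpha>\<in>\<Gamma>. \<forall>i. a \<alpha> i = 0 \<and> b \<alpha> i = 0 \<and> c \<alpha> i = 0 \<and> d \<alpha> i = 0)" (is "?l \<longleftrightarrow> ?r")
proof
  assume l: ?l
  show ?r
  proof (intro ballI allI)
    fix \<alpha> i assume "\<alpha> \<in> \<Gamma>"
    then have "twist \<Gamma> a b c d (Poly_Mapping.single (LI \<alpha> i) 1) = L_laurent \<alpha> (a \<alpha> i * tpow i) + H_laurent \<alpha> (b \<alpha> i * tpow i)"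
      "twist \<Gamma> a b c d (Poly_Mapping.single (HI \<alpha> i) 1) = L_laurent \<alpha> (c \<alpha> i * tpow i) + H_laurent \<alpha> (d \<alpha> i * tpow i)"
      by (simp_all add: twist_def hv_extend_single)
    then have "L_laurent \<alpha> (a \<alpha> i * tpow i) + H_laurent \<alpha> (b \<alpha> i * tpow i) = L_laurent \<alpha> 0 + H_laurent \<alpha> 0"
      "L_laurent \<alpha> (c \<alpha> i * tpow i) + H_laurent \<alpha> (d \<alpha> i * tpow i) = L_laurent \<alpha> 0 + H_laurent \<alpha> 0"
      using l by (simp_all add: laurent_linear)
    then show "a \<alpha> i = 0 \<and> b \<alpha> i = 0 \<and> c \<alpha> i = 0 \<and> d \<alpha> i = 0"
      unfolding laurent_pair_eq_iff by simp
  qed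
next
  assume ?r
  then have "twist \<Gamma> a b c d = twist \<Gamma> (\<lambda>_ _. 0) (\<lambda>_ _. 0) (\<lambda>_ _. 0) (\<lambda>_ _. 0)"
    by (intro twist_cong) auto
  also have "\<dots> = 0"
    by (auto simp: twist_def hv_extend_def laurent_linear lift_def fun_eq_iff split: hv_index.splits intro!: sum.neutral)
  finally show ?l .
qed

lemma laurent_act_basis:
  "laurent_act p (L_basis \<alpha> i) = L_laurent \<alpha> (p * tpow i)"
  "laurent_act p (H_basis \<alpha> i) = H_laurent \<alpha> (p * tpow i)"
  by (simp_all add: laurent_act_def L_basis_def H_basis_def)

lemma D_hom_eq_twist: "D_hom \<Gamma> \<phi> = twist \<Gamma> (\<lambda>\<alpha> i. \<phi> \<alpha>) (\<lambda>_ _. 0) (\<lambda>_ _. 0) (\<lambda>\<alpha> i. \<phi> \<alpha>)"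
  unfolding D_hom_def twist_def
  by (rule hv_extend_cong) (auto simp: laurent_act_basis laurent_linear split: hv_index.splits)

lemma D_g_eq_twist: "D_g \<Gamma> g = twist \<Gamma> (\<lambda>_ _. 0) (\<lambda>\<alpha> i. g \<alpha>) (\<lambda>_ _. 0) (\<lambda>_ _. 0)"
  unfolding D_g_def twist_def
  by (rule hv_extend_cong) (auto simp: laurent_act_basis laurent_linear split: hv_index.splits)

lemma D_mult_eq_twist: "D_mult \<Gamma> q = twist \<Gamma> (\<lambda>_ _. 0) (\<lambda>_ _. 0) (\<lambda>_ _. 0) (\<lambda>_ _. q)"
  unfolding D_mult_def twist_def
  by (rule hv_extend_cong) (auto simp: laurent_act_basis laurent_linear split: hv_index.splits)

text \<open>
  Since \<open>d/dt\<close> lowers the exponent by one and multiplies by it, splitting off \<open>tpow i\<close> leaves an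
  entry that is linear in \<open>i\<close> with slope \<open>p * tpow (- 1)\<close>.
\<close>

lemma D_loop_eq_twist:
  "D_loop \<Gamma> (\<lambda>f. p * ddt f) = twist \<Gamma> (\<lambda>\<alpha> i. scale (of_int i) (p * tpow (- 1))) (\<lambda>_ _. 0) (\<lambda>_ _. 0)
     (\<lambda>\<alpha> i. scale (of_int i) (p * tpow (- 1)))"
proof -
  have "p * ddt (tpow i) = scale (of_int i) (p * tpow (- 1)) * tpow i" for i
    by (simp add: ddt_tpow scale_mult_left scale_mult_right mult.assoc flip: tpow_add)
  then show ?thesis
    unfolding D_loop_def twist_def
    by (intro hv_extend_cong) (auto simp: laurent_linear split: hv_index.splits)
qed

lemmas D_eq_twist = D_hom_eq_twist D_g_eq_twist D_mult_eq_twist D_loop_eq_twist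


section \<open>Solving the functional equations\<close>

text \<open>
  The factor \<open>\<alpha> - \<beta>\<close> in the bracket hides additivity on the diagonal \<open>\<alpha> = \<beta>\<close>. It is recovered by a
  detour: adding \<open>- \<alpha>\<close> to \<open>\<alpha> + \<alpha>\<close> leads back to \<open>\<alpha>\<close> through sums of distinct elements, and in
  degree zero one passes through \<open>\<gamma> + (- \<gamma>)\<close> for a nonzero \<open>\<gamma>\<close>. Distinctness of \<open>\<alpha>\<close> from
  \<open>- \<alpha>\<close> and of \<open>\<alpha> + \<alpha>\<close> from \<open>- \<alpha>\<close> uses characteristic zero.
\<close>

lemma additive_off_diagonal_imp_additive:
  fixes A :: "'a::field_char_0 \<Rightarrow> 'i::monoid_add \<Rightarrow> 'b::ab_group_add"
  assumes \<Gamma>: "add_subgroup \<Gamma>" "\<Gamma> \<noteq> {0}"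
    and A: "\<And>\<alpha> \<beta> i j. \<alpha> \<in> \<Gamma> \<Longrightarrow> \<beta> \<in> \<Gamma> \<Longrightarrow> \<alpha> \<noteq> \<beta> \<Longrightarrow> A (\<alpha> + \<beta>) (i + j) = A \<alpha> i + A \<beta> j"
    and \<alpha>: "\<alpha> \<in> \<Gamma>" and \<beta>: "\<beta> \<in> \<Gamma>"
  shows "A (\<alpha> + \<beta>) (i + j) = A \<alpha> i + A \<beta> j"
proof -
  have closed: "0 \<in> \<Gamma>" "\<And>x y. x \<in> \<Gamma> \<Longrightarrow> y \<in> \<Gamma> \<Longrightarrow> x + y \<in> \<Gamma>" "\<And>x. x \<in> \<Gamma> \<Longrightarrow> - x \<in> \<Gamma>"
    using \<Gamma>(1) by (auto simp: add_subgroup_def)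
  have neg: "x \<noteq> - x" if "x \<noteq> 0" for x :: 'a
    using that by simp
  consider "\<alpha> \<noteq> \<beta>" | "\<alpha> = \<beta>" "\<alpha> \<noteq> 0" | "\<alpha> = 0" "\<beta> = 0" by auto
  then show ?thesis
  proof cases
    case 1
    then show ?thesis using A \<alpha> \<beta> by blast
  next
    case 2
    have "\<alpha> + \<alpha> \<noteq> - \<alpha>"
    proof
      assume "\<alpha> + \<alpha> = - \<alpha>"
      then have "3 * \<alpha> = 0" by (simp add: eq_neg_iff_add_eq_0)
      with 2 show False by simp
    qed
    then have "A (\<alpha> + \<alpha> + - \<alpha>) (i + j + 0) = A (\<alpha> + \<alpha>) (i + j) + A (- \<alpha>) 0"
      using \<alpha> closed by (intro A) blast+
    moreover have "A (\<alpha> + 0) (i + j) = A \<alpha> i + A 0 j"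
      using \<alpha> closed 2 by (intro A) auto
    moreover have "A (\<alpha> + - \<alpha>) (j + 0) = A \<alpha> j + A (- \<alpha>) 0"
      using \<alpha> closed 2 neg by (intro A) auto
    ultimately show ?thesis using 2 by (simp add: algebra_simps)
  next
    case 3
    obtain \<gamma> where \<gamma>: "\<gamma> \<in> \<Gamma>" "\<gamma> \<noteq> 0" using \<Gamma>(2) closed(1) by blast
    have "A (\<gamma> + - \<gamma>) (i + j) = A \<gamma> i + A (- \<gamma>) j" "A (\<gamma> + - \<gamma>) (0 + 0) = A \<gamma> 0 + A (- \<gamma>) 0"
      using \<gamma> closed neg by (intro A; auto)+
    moreover have "A (\<gamma> + 0) (0 + 0) = A \<gamma> 0 + A 0 0" "A (\<gamma> + 0) (0 + i) = A \<gamma> 0 + A 0 i"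
      "A (- \<gamma> + 0) (0 + j) = A (- \<gamma>) 0 + A 0 j"
      using \<gamma> closed by (intro A; auto)+
    ultimately show ?thesis using 3 by (simp add: algebra_simps)
  qed
qed

lemma additive_int:
  fixes f :: "int \<Rightarrow> 'k \<Rightarrow>\<^sub>0 'a::field"
  assumes f: "\<And>i j. f (i + j) = f i + f j"
  shows "f i = scale (of_int i) (f 1)"
proof (induction i rule: int_induct[where k = 0])
  case base
  show ?case using f[of 0 0] by simp
next
  case (step1 i)
  then show ?case by (simp add: f pm.scale_left_distrib)
next
  case (step2 i)
  then show ?case using f[of "i - 1" 1] by (simp add: pm.scale_left_diff_distrib algebra_simps)
qed

text \<open>
  In each equation the scalar factors cancel for a suitable choice of degrees. Degree zero, where most
  of them vanish, is reached from a nonzero \<open>\<gamma> \<in> \<Gamma>\<close>, as the sum of \<open>\<gamma>\<close> and \<open>- \<gamma>\<close> or of \<open>\<gamma>\<close> and \<open>0\<close>.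
\<close>

lemma twist_cocycle_solution:
  fixes \<Gamma> :: "'a::field_char_0 set"
  assumes \<Gamma>: "add_subgroup \<Gamma>" "\<Gamma> \<noteq> {0}" and cocycle: "twist_cocycle \<Gamma> a b c d"
  obtains \<phi> g r q where "\<phi> \<in> Hom_Z \<Gamma>" "g \<in> g_space \<Gamma>"
    "\<forall>\<alpha>\<in>\<Gamma>. \<forall>i. a \<alpha> i = \<phi> \<alpha> + scale (of_int i) r"
    "\<forall>\<alpha>\<in>\<Gamma>. \<forall>i. b \<alpha> i = g \<alpha>"
    "\<forall>\<alpha>\<in>\<Gamma>. \<forall>i. c \<alpha> i = 0"
    "\<forall>\<alpha>\<in>\<Gamma>. \<forall>i. d \<alpha> i = a \<alpha> i + q"
proof -
  have closed: "0 \<in> \<Gamma>" "\<And>x y. x \<in> \<Gamma> \<Longrightarrow> y \<in> \<Gamma> \<Longrightarrow> x + y \<in> \<Gamma>" "\<And>x. x \<in> \<Gamma> \<Longrightarrow> - x \<in> \<Gamma>"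
    using \<Gamma>(1) by (auto simp: add_subgroup_def)
  obtain \<gamma> where \<gamma>: "\<gamma> \<in> \<Gamma>" "\<gamma> \<noteq> 0" using \<Gamma>(2) closed(1) by blast
  have eqs: "scale (\<alpha> - \<beta>) (a (\<alpha> + \<beta>) (i + j)) = scale (\<alpha> - \<beta>) (a \<alpha> i + a \<beta> j)"
    "scale (\<alpha> - \<beta>) (b (\<alpha> + \<beta>) (i + j)) = scale \<alpha> (b \<alpha> i) - scale \<beta> (b \<beta> j)"
    "scale (- \<beta>) (c (\<alpha> + \<beta>) (i + j)) = scale (\<alpha> - \<beta>) (c \<beta> j)"
    "scale \<beta> (d (\<alpha> + \<beta>) (i + j)) = scale \<beta> (a \<alpha> i + d \<beta> j)"
    if "\<alpha> \<in> \<Gamma>" "\<beta> \<in> \<Gamma>" for \<alpha> \<beta> i j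
    using cocycle that unfolding twist_cocycle_def by blast+

  have a: "a (\<alpha> + \<beta>) (i + j) = a \<alpha> i + a \<beta> j" if "\<alpha> \<in> \<Gamma>" "\<beta> \<in> \<Gamma>" for \<alpha> \<beta> i j
    using \<Gamma> _ that
  proof (rule additive_off_diagonal_imp_additive)
    show "a (x + y) (k + l) = a x k + a y l" if "x \<in> \<Gamma>" "y \<in> \<Gamma>" "x \<noteq> y" for x y k l
      using eqs(1)[OF that(1,2)] that(3) by simp
  qed
  have a0: "a 0 i = scale (of_int i) (a 0 1)" for i
    using a[OF closed(1) closed(1)] by (intro additive_int) simp
  have a_split: "a \<alpha> i = a \<alpha> 0 + scale (of_int i) (a 0 1)" if "\<alpha> \<in> \<Gamma>" for \<alpha> i
    using a[OF that closed(1), of 0 i] by (simp add: a0[of i])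

  \<comment> \<open>in nonzero degree take \<open>\<beta> = 0\<close>; degree zero is the sum of \<open>\<gamma>\<close> and \<open>- \<gamma>\<close>\<close>
  have b: "b \<alpha> i = b \<alpha> 0" if "\<alpha> \<in> \<Gamma>" for \<alpha> i
  proof -
    have nz: "b \<beta> i = b \<beta> 0" if "\<beta> \<in> \<Gamma>" "\<beta> \<noteq> 0" for \<beta> i
      using eqs(2)[OF that(1) closed(1), of 0 i] that(2) by simp
    have "scale (\<gamma> - - \<gamma>) (b 0 i) = scale (\<gamma> - - \<gamma>) (b 0 0)" for i
      using eqs(2)[OF \<gamma>(1) closed(3)[OF \<gamma>(1)], of i 0] eqs(2)[OF \<gamma>(1) closed(3)[OF \<gamma>(1)], of 0 0] nz[OF \<gamma>, of i]
      by simp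
    moreover have "\<gamma> - - \<gamma> \<noteq> 0" using \<gamma>(2) by (simp flip: mult_2)
    ultimately have "b 0 i = b 0 0" by (simp only: pm.scale_cancel_left simp_thms)
    then show ?thesis using nz[OF that] by (cases "\<alpha> = 0") simp_all
  qed

  \<comment> \<open>first degree zero, then the pair \<open>(- \<alpha>, \<alpha>)\<close> with the scalar \<open>- 2 \<alpha>\<close> on the right\<close>
  have c0: "c 0 i = 0" for i
    using eqs(3)[OF \<gamma>(1) closed(1), of i i] \<gamma>(2) by simp
  have c: "c \<alpha> i = 0" if "\<alpha> \<in> \<Gamma>" for \<alpha> i
    using eqs(3)[OF closed(3)[OF that] that, of i i] c0 by (cases "\<alpha> = 0") (simp_all flip: mult_2)

  \<comment> \<open>\<open>d - a\<close> is invariant under translation by \<open>\<Gamma> \<times> \<int>\<close>, so it equals its value at \<open>(\<gamma>, 0)\<close>\<close>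
  have d: "d \<alpha> i = a \<alpha> i + (d \<gamma> 0 - a \<gamma> 0)" if "\<alpha> \<in> \<Gamma>" for \<alpha> i
  proof -
    have \<delta>: "\<alpha> - \<gamma> \<in> \<Gamma>" using closed(2)[OF that closed(3)[OF \<gamma>(1)]] by simp
    have "d \<alpha> i = a (\<alpha> - \<gamma>) i + d \<gamma> 0"
      using eqs(4)[OF \<delta> \<gamma>(1), of i 0] \<gamma>(2) by simp
    then show ?thesis
      using a[OF \<delta> \<gamma>(1), of i 0] by (simp add: algebra_simps)
  qed

  show ?thesis
  proof (rule that[of "\<lambda>\<alpha>. a \<alpha> 0" "\<lambda>\<alpha>. b \<alpha> 0" "a 0 1" "d \<gamma> 0 - a \<gamma> 0"])
    show "(\<lambda>\<alpha>. a \<alpha> 0) \<in> Hom_Z \<Gamma>" using a[where i = 0 and j = 0] by (simp add: Hom_Z_def)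
    show "(\<lambda>\<alpha>. b \<alpha> 0) \<in> g_space \<Gamma>" using eqs(2)[where i = 0 and j = 0] by (simp add: g_space_def)
  qed (blast intro: a_split b c d)+
qed


section \<open>Reduction to degree zero\<close>

lemma lookup_lift_diag:
  "Poly_Mapping.lookup (lift (\<lambda>u. scale (w u) (Poly_Mapping.single u 1)) x) u = w u * Poly_Mapping.lookup x u"
proof -
  have "Poly_Mapping.lookup (lift (\<lambda>u. scale (w u) (Poly_Mapping.single u 1)) x) u
      = (\<Sum>v\<in>Poly_Mapping.keys x. if v = u then w u * Poly_Mapping.lookup x u else 0)"
    unfolding lift_def lookup_sum by (rule sum.cong) (auto simp: lookup_single when_def)
  then show ?thesis by (simp add: in_keys_iff)
qed

lemma lookup_bracket_L00:
  "Poly_Mapping.lookup (bracket x (L_basis 0 0)) u = degree_of u * Poly_Mapping.lookup x u"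
proof -
  have "bracket x (L_basis 0 0) = lift (\<lambda>u. scale (degree_of u) (Poly_Mapping.single u 1)) x"
    unfolding bracket_def
  proof (rule arg_cong[where f = "\<lambda>f. lift f x"], rule ext)
    fix u :: "'a hv_index"
    show "lift (bracket_index u) (L_basis 0 0) = scale (degree_of u) (Poly_Mapping.single u 1)"
      by (cases u) (simp_all add: L_basis_def H_basis_def)
  qed
  then show ?thesis by (simp add: lookup_lift_diag)
qed

text \<open>
  A basis vector \<open>x\<close> of degree \<open>\<beta>\<close> satisfies \<open>[x, L_basis 0 0] = \<beta> x\<close>. Applying \<open>D\<close> and reading off
  degree \<open>\<gamma> \<noteq> \<beta>\<close> gives \<open>\<beta> z = \<gamma> z\<close> for that component \<open>z\<close> of \<open>D x\<close>, since \<open>[x, D (L_basis 0 0)]\<close>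
  lives in degree \<open>\<beta>\<close>.
\<close>

lemma Der_homogeneous:
  assumes D: "D \<in> Der \<Gamma>" and \<Gamma>: "add_subgroup \<Gamma>" and L0: "homogeneous 0 (D (L_basis 0 0))"
    and u: "degree_of u \<in> \<Gamma>"
  shows "homogeneous (degree_of u) (D (Poly_Mapping.single u 1))"
  unfolding homogeneous_def
proof (intro allI impI)
  fix v assume v: "degree_of v \<noteq> degree_of u"
  let ?u = "Poly_Mapping.single u (1::'a)" and ?L = "L_basis (0::'a) 0"
  have mem: "?u \<in> hv_algebra \<Gamma>" "?L \<in> hv_algebra \<Gamma>"
    using u \<Gamma> by (auto simp: L_basis_def add_subgroup_def intro!: single_in_hv_algebra)
  have eigen: "bracket ?u ?L = scale (degree_of u) ?u"
    by (rule poly_mapping_eqI) (auto simp: lookup_bracket_L00 lookup_single when_def)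
  have "scale (degree_of u) (D ?u) = D (bracket ?u ?L)"
    using D mem unfolding eigen Der_def endos_def by auto
  also have "\<dots> = bracket (D ?u) ?L + bracket ?u (D ?L)"
    using D mem unfolding Der_def by blast
  finally have "Poly_Mapping.lookup (scale (degree_of u) (D ?u)) v
     = Poly_Mapping.lookup (bracket (D ?u) ?L + bracket ?u (D ?L)) v" by simp
  moreover have "Poly_Mapping.lookup (bracket ?u (D ?L)) v = 0"
    using homogeneous_bracket[OF homogeneous_single L0, of u 1] v by (simp add: homogeneous_def)
  ultimately have "degree_of u * Poly_Mapping.lookup (D ?u) v = degree_of v * Poly_Mapping.lookup (D ?u) v"
    by (simp add: lookup_add lookup_bracket_L00)
  then show "Poly_Mapping.lookup (D ?u) v = 0" using v by auto
qed

lemma homogeneous_endo_is_twist: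
  assumes D: "D \<in> endos \<Gamma>"
    and hom: "\<And>u. degree_of u \<in> \<Gamma> \<Longrightarrow> homogeneous (degree_of u) (D (Poly_Mapping.single u 1))"
  obtains a b c d where "D = twist \<Gamma> a b c d"
proof
  have "D = hv_extend \<Gamma> (\<lambda>u. D (Poly_Mapping.single u 1))" by (rule endos_eq_hv_extend[OF D])
  also have "\<dots> = twist \<Gamma> (\<lambda>\<alpha> i. L_coeff \<alpha> (D (Poly_Mapping.single (LI \<alpha> i) 1)) * tpow (- i))
      (\<lambda>\<alpha> i. H_coeff \<alpha> (D (Poly_Mapping.single (LI \<alpha> i) 1)) * tpow (- i))
      (\<lambda>\<alpha> i. L_coeff \<alpha> (D (Poly_Mapping.single (HI \<alpha> i) 1)) * tpow (- i))
      (\<lambda>\<alpha> i. H_coeff \<alpha> (D (Poly_Mapping.single (HI \<alpha> i) 1)) * tpow (- i))"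
    unfolding twist_def
  proof (rule hv_extend_cong)
    fix u assume "degree_of u \<in> \<Gamma>"
    from homogeneous_decomp[OF hom[OF this]]
    show "D (Poly_Mapping.single u 1) = (case u of
        LI \<alpha> i \<Rightarrow> L_laurent \<alpha> (L_coeff \<alpha> (D (Poly_Mapping.single (LI \<alpha> i) 1)) * tpow (- i) * tpow i)
          + H_laurent \<alpha> (H_coeff \<alpha> (D (Poly_Mapping.single (LI \<alpha> i) 1)) * tpow (- i) * tpow i)
      | HI \<alpha> i \<Rightarrow> L_laurent \<alpha> (L_coeff \<alpha> (D (Poly_Mapping.single (HI \<alpha> i) 1)) * tpow (- i) * tpow i)
          + H_laurent \<alpha> (H_coeff \<alpha> (D (Poly_Mapping.single (HI \<alpha> i) 1)) * tpow (- i) * tpow i))"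
      by (cases u) simp_all
  qed
  finally show "D = twist \<Gamma> (\<lambda>\<alpha> i. L_coeff \<alpha> (D (Poly_Mapping.single (LI \<alpha> i) 1)) * tpow (- i))
      (\<lambda>\<alpha> i. H_coeff \<alpha> (D (Poly_Mapping.single (LI \<alpha> i) 1)) * tpow (- i))
      (\<lambda>\<alpha> i. L_coeff \<alpha> (D (Poly_Mapping.single (HI \<alpha> i) 1)) * tpow (- i))
      (\<lambda>\<alpha> i. H_coeff \<alpha> (D (Poly_Mapping.single (HI \<alpha> i) 1)) * tpow (- i))" .
qed

text \<open>
  Bracketing with \<open>L_basis 0 0\<close> is invertible away from degree zero, so the part of \<open>D (L_basis 0 0)\<close> of
  nonzero degree is \<open>[y, L_basis 0 0]\<close> for some \<open>y\<close>.
\<close>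

lemma Der_mod_inner_is_twist:
  assumes D: "D \<in> Der \<Gamma>" and \<Gamma>: "add_subgroup \<Gamma>"
  obtains y a b c d where "y \<in> hv_algebra \<Gamma>" "twist_cocycle \<Gamma> a b c d" "D = ad \<Gamma> y + twist \<Gamma> a b c d"
proof -
  let ?L = "L_basis (0::'a) 0"
  have L: "?L \<in> hv_algebra \<Gamma>"
    using \<Gamma> by (auto simp: L_basis_def add_subgroup_def intro!: single_in_hv_algebra)
  \<comment> \<open>\<open>inverse 0 = 0\<close>, so \<open>y\<close> has no component of degree zero\<close>
  define y where "y = lift (\<lambda>u. scale (inverse (degree_of u)) (Poly_Mapping.single u 1)) (D ?L)"
  have "D ?L \<in> hv_algebra \<Gamma>" using D L by (auto simp: Der_def endos_def)
  then have y: "y \<in> hv_algebra \<Gamma>"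
    unfolding y_def by (intro lift_in_hv_algebra hv_scale single_in_hv_algebra)
  define E where "E = D + ad \<Gamma> (- y)"
  have my: "- y \<in> hv_algebra \<Gamma>" using hv_scale[OF y, of "- 1"] by simp
  have E: "E \<in> Der \<Gamma>" unfolding E_def by (intro Der_add ad_in_Der D \<Gamma> my)
  have "homogeneous 0 (E ?L)"
    by (auto simp: E_def ad_def L homogeneous_def lookup_add lookup_minus bracket_simps lookup_bracket_L00 y_def lookup_lift_diag)
  then have hom: "homogeneous (degree_of u) (E (Poly_Mapping.single u 1))" if "degree_of u \<in> \<Gamma>" for u
    using Der_homogeneous[OF E \<Gamma>] that by blast
  obtain a b c d where t: "E = twist \<Gamma> a b c d"
  proof (rule homogeneous_endo_is_twist[OF _ hom])
    show "E \<in> endos \<Gamma>" using E by (simp add: Der_def)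
  qed blast
  have "D = ad \<Gamma> y + twist \<Gamma> a b c d"
    unfolding t[symmetric] E_def by (auto simp: ad_def bracket_simps fun_eq_iff)
  moreover have "twist_cocycle \<Gamma> a b c d" using E unfolding t twist_Der_iff[OF \<Gamma>] .
  ultimately show ?thesis using that y by blast
qed


section \<open>The decomposition\<close>

lemma outer_in_Der:
  assumes "add_subgroup \<Gamma>"
  shows "Ders_hom \<Gamma> \<subseteq> Der \<Gamma>" "Ders_g \<Gamma> \<subseteq> Der \<Gamma>" "Ders_mult \<Gamma> \<subseteq> Der \<Gamma>" "Ders_loop \<Gamma> \<subseteq> Der \<Gamma>"
proof -
  have "D_hom \<Gamma> \<phi> \<in> Der \<Gamma>" if "\<phi> \<in> Hom_Z \<Gamma>" for \<phi>
    using that unfolding D_hom_eq_twist twist_Der_iff[OF assms] twist_cocycle_def Hom_Z_def by simp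
  then show "Ders_hom \<Gamma> \<subseteq> Der \<Gamma>" by (auto simp: Ders_hom_def)
  have "D_g \<Gamma> g \<in> Der \<Gamma>" if "g \<in> g_space \<Gamma>" for g
    using that unfolding D_g_eq_twist twist_Der_iff[OF assms] twist_cocycle_def g_space_def by simp
  then show "Ders_g \<Gamma> \<subseteq> Der \<Gamma>" by (auto simp: Ders_g_def)
  have "D_mult \<Gamma> q \<in> Der \<Gamma>" for q
    unfolding D_mult_eq_twist twist_Der_iff[OF assms] twist_cocycle_def by simp
  then show "Ders_mult \<Gamma> \<subseteq> Der \<Gamma>" by (auto simp: Ders_mult_def)
  have "D_loop \<Gamma> (\<lambda>f. p * ddt f) \<in> Der \<Gamma>" for p
    unfolding D_loop_eq_twist twist_Der_iff[OF assms] twist_cocycle_def of_int_add pm.scale_left_distrib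
    by simp
  then show "Ders_loop \<Gamma> \<subseteq> Der \<Gamma>" by (auto simp: Ders_loop_def laurent_ders_def)
qed

lemma outer_subspaces:
  "endo.subspace (Ders_hom \<Gamma>)" "endo.subspace (Ders_g \<Gamma>)" "endo.subspace (Ders_mult \<Gamma>)" "endo.subspace (Ders_loop \<Gamma>)"
proof -
  show "endo.subspace (Ders_hom \<Gamma>)"
    unfolding Ders_hom_def
  proof (rule endo.subspaceI; (elim imageE, hypsubst)?)
    show "0 \<in> D_hom \<Gamma> ` Hom_Z \<Gamma>"
      by (rule image_eqI[of _ _ "\<lambda>_. 0"]) (auto simp: D_eq_twist twist_eq_0_iff Hom_Z_def intro!: sym[of _ 0])
  next
    fix \<phi> \<psi> assume "\<phi> \<in> Hom_Z \<Gamma>" "\<psi> \<in> Hom_Z \<Gamma>"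
    then show "D_hom \<Gamma> \<phi> + D_hom \<Gamma> \<psi> \<in> D_hom \<Gamma> ` Hom_Z \<Gamma>"
      by (intro image_eqI[of _ _ "\<lambda>\<alpha>. \<phi> \<alpha> + \<psi> \<alpha>"]) (auto simp: D_eq_twist twist_add Hom_Z_def)
  next
    fix k \<phi> assume "\<phi> \<in> Hom_Z \<Gamma>"
    then show "scale_endo k (D_hom \<Gamma> \<phi>) \<in> D_hom \<Gamma> ` Hom_Z \<Gamma>"
      by (intro image_eqI[of _ _ "\<lambda>\<alpha>. scale k (\<phi> \<alpha>)"])
        (auto simp: D_eq_twist twist_scale Hom_Z_def pm.scale_right_distrib)
  qed
  show "endo.subspace (Ders_g \<Gamma>)"
    unfolding Ders_g_def
  proof (rule endo.subspaceI; (elim imageE, hypsubst)?)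
    show "0 \<in> D_g \<Gamma> ` g_space \<Gamma>"
      by (rule image_eqI[of _ _ "\<lambda>_. 0"]) (auto simp: D_eq_twist twist_eq_0_iff g_space_def intro!: sym[of _ 0])
  next
    fix g h assume "g \<in> g_space \<Gamma>" "h \<in> g_space \<Gamma>"
    then show "D_g \<Gamma> g + D_g \<Gamma> h \<in> D_g \<Gamma> ` g_space \<Gamma>"
      by (intro image_eqI[of _ _ "\<lambda>\<alpha>. g \<alpha> + h \<alpha>"])
        (auto simp: D_eq_twist twist_add g_space_def pm.scale_right_distrib)
  next
    fix k g assume "g \<in> g_space \<Gamma>"
    then have "scale k (scale (\<alpha> - \<beta>) (g (\<alpha> + \<beta>))) = scale k (scale \<alpha> (g \<alpha>) - scale \<beta> (g \<beta>))"
      if "\<alpha> \<in> \<Gamma>" "\<beta> \<in> \<Gamma>" for \<alpha> \<beta> using that by (simp add: g_space_def)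
    then show "scale_endo k (D_g \<Gamma> g) \<in> D_g \<Gamma> ` g_space \<Gamma>"
      by (intro image_eqI[of _ _ "\<lambda>\<alpha>. scale k (g \<alpha>)"])
        (auto simp: D_eq_twist twist_scale g_space_def pm.scale_right_diff_distrib mult.commute)
  qed
  show "endo.subspace (Ders_mult \<Gamma>)"
    unfolding Ders_mult_def
  proof (rule endo.subspaceI; (elim imageE, hypsubst)?)
    show "0 \<in> range (D_mult \<Gamma>)"
      by (rule image_eqI[of _ _ 0]) (auto simp: D_eq_twist twist_eq_0_iff intro!: sym[of _ 0])
  next
    fix p q show "D_mult \<Gamma> p + D_mult \<Gamma> q \<in> range (D_mult \<Gamma>)"
      by (intro image_eqI[of _ _ "p + q"]) (auto simp: D_eq_twist twist_add)
  next
    fix k p show "scale_endo k (D_mult \<Gamma> p) \<in> range (D_mult \<Gamma>)"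
      by (intro image_eqI[of _ _ "scale k p"]) (auto simp: D_eq_twist twist_scale)
  qed
  have loop: "Ders_loop \<Gamma> = range (\<lambda>p. D_loop \<Gamma> (\<lambda>f. p * ddt f))"
    by (auto simp: Ders_loop_def laurent_ders_def)
  show "endo.subspace (Ders_loop \<Gamma>)"
    unfolding loop
  proof (rule endo.subspaceI; (elim imageE, hypsubst)?)
    show "0 \<in> range (\<lambda>p. D_loop \<Gamma> (\<lambda>f. p * ddt f))"
      using D_loop_eq_twist[of \<Gamma> 0] by (intro image_eqI[of _ _ 0]) (auto simp: twist_eq_0_iff intro!: sym[of _ 0])
  next
    fix p q show "D_loop \<Gamma> (\<lambda>f. p * ddt f) + D_loop \<Gamma> (\<lambda>f. q * ddt f) \<in> range (\<lambda>p. D_loop \<Gamma> (\<lambda>f. p * ddt f))"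
      by (intro image_eqI[of _ _ "p + q"]) (simp_all only: D_loop_eq_twist twist_add distrib_right[of p q "tpow _"] pm.scale_right_distrib add_0 UNIV_I)
  next
    fix k p show "scale_endo k (D_loop \<Gamma> (\<lambda>f. p * ddt f)) \<in> range (\<lambda>p. D_loop \<Gamma> (\<lambda>f. p * ddt f))"
      by (intro image_eqI[of _ _ "scale k p"]) (simp_all only: D_loop_eq_twist twist_scale UNIV_I, simp add: scale_mult_left mult.commute)
  qed
qed

text \<open>
  The \<open>L\<close> to \<open>H\<close> entry isolates \<open>g\<close>. The \<open>L\<close> to \<open>L\<close> entry is \<open>\<phi> \<alpha>\<close> at exponent \<open>0\<close>, and at exponent \<open>1\<close>
  it then yields \<open>p\<close>; what remains of the \<open>H\<close> to \<open>H\<close> entry is \<open>q\<close>.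
\<close>

lemma outer_direct_sum:
  assumes "add_subgroup \<Gamma>"
  shows "direct_sum4 (Ders_hom \<Gamma>) (Ders_g \<Gamma>) (Ders_mult \<Gamma>) (Ders_loop \<Gamma>)"
  unfolding direct_sum4_def
proof (intro conjI outer_subspaces ballI impI)
  fix A B C E
  assume "A \<in> Ders_hom \<Gamma>" "B \<in> Ders_g \<Gamma>" "C \<in> Ders_mult \<Gamma>" "E \<in> Ders_loop \<Gamma>" and sum: "A + B + C + E = 0"
  then obtain \<phi> g q p where eq: "A = D_hom \<Gamma> \<phi>" "B = D_g \<Gamma> g" "C = D_mult \<Gamma> q" "E = D_loop \<Gamma> (\<lambda>f. p * ddt f)"
    by (auto simp: Ders_hom_def Ders_g_def Ders_mult_def Ders_loop_def laurent_ders_def)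
  have 0: "0 \<in> \<Gamma>" using assms by (simp add: add_subgroup_def)
  have z: "\<phi> \<alpha> + scale (of_int i) (p * tpow (- 1)) = 0 \<and> g \<alpha> = 0 \<and> \<phi> \<alpha> + q + scale (of_int i) (p * tpow (- 1)) = 0"
    if "\<alpha> \<in> \<Gamma>" for \<alpha> i
    using sum that unfolding eq D_eq_twist twist_add twist_eq_0_iff by auto
  have \<phi>: "\<phi> \<alpha> = 0" if "\<alpha> \<in> \<Gamma>" for \<alpha> using z[OF that, of 0] by simp
  have "p = 0" using z[OF 0, of 1] \<phi>[OF 0] by simp
  moreover have "q = 0" using z[OF 0, of 0] \<phi>[OF 0] by simp
  ultimately show "A = 0" "B = 0" "C = 0" "E = 0"
    using \<phi> z unfolding eq D_eq_twist twist_eq_0_iff by auto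
qed

theorem theorem5:
  fixes \<Gamma> :: "'a::{alg_closed_field, field_char_0} set"
  assumes "add_subgroup \<Gamma>" and "\<Gamma> \<noteq> {0}"
  shows "Der \<Gamma> = inner_ders \<Gamma> + (Ders_hom \<Gamma> + Ders_g \<Gamma> + Ders_mult \<Gamma> + Ders_loop \<Gamma>) \<and>
    direct_sum4 (Ders_hom \<Gamma>) (Ders_g \<Gamma>) (Ders_mult \<Gamma>) (Ders_loop \<Gamma>)"
proof (intro conjI equalityI subsetI)
  fix D assume "D \<in> Der \<Gamma>"
  then obtain y a b c d where y: "y \<in> hv_algebra \<Gamma>" and cocycle: "twist_cocycle \<Gamma> a b c d"
    and D: "D = ad \<Gamma> y + twist \<Gamma> a b c d"
    by (rule Der_mod_inner_is_twist[OF _ assms(1)])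
  obtain \<phi> g r q where sol: "\<phi> \<in> Hom_Z \<Gamma>" "g \<in> g_space \<Gamma>"
    "\<forall>\<alpha>\<in>\<Gamma>. \<forall>i. a \<alpha> i = \<phi> \<alpha> + scale (of_int i) r"
    "\<forall>\<alpha>\<in>\<Gamma>. \<forall>i. b \<alpha> i = g \<alpha>"
    "\<forall>\<alpha>\<in>\<Gamma>. \<forall>i. c \<alpha> i = 0"
    "\<forall>\<alpha>\<in>\<Gamma>. \<forall>i. d \<alpha> i = a \<alpha> i + q"
    by (rule twist_cocycle_solution[OF assms cocycle])
  \<comment> \<open>the slope \<open>r\<close> of \<open>a\<close> in the exponent is \<open>p * tpow (- 1)\<close> for the multiplier \<open>p\<close> of \<open>ddt\<close>\<close>
  have "twist \<Gamma> a b c d = D_hom \<Gamma> \<phi> + D_g \<Gamma> g + D_mult \<Gamma> q + D_loop \<Gamma> (\<lambda>f. (r * tpow 1) * ddt f)"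
    unfolding D_eq_twist twist_add by (rule twist_cong) (simp_all add: sol add_ac)
  moreover have "(\<lambda>f. (r * tpow 1) * ddt f) \<in> laurent_ders" by (auto simp: laurent_ders_def)
  ultimately show "D \<in> inner_ders \<Gamma> + (Ders_hom \<Gamma> + Ders_g \<Gamma> + Ders_mult \<Gamma> + Ders_loop \<Gamma>)"
    using y sol(1,2) unfolding D
    by (auto simp: inner_ders_def Ders_hom_def Ders_g_def Ders_mult_def Ders_loop_def intro!: set_plus_intro)
next
  fix D assume "D \<in> inner_ders \<Gamma> + (Ders_hom \<Gamma> + Ders_g \<Gamma> + Ders_mult \<Gamma> + Ders_loop \<Gamma>)"
  then obtain I A B C E where D: "D = I + (A + B + C + E)" and "I \<in> inner_ders \<Gamma>"
    "A \<in> Ders_hom \<Gamma>" "B \<in> Ders_g \<Gamma>" "C \<in> Ders_mult \<Gamma>" "E \<in> Ders_loop \<Gamma>"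
    by (elim set_plus_elim) blast
  moreover have "I \<in> Der \<Gamma>" if "I \<in> inner_ders \<Gamma>" for I
    using that ad_in_Der[OF assms(1)] by (auto simp: inner_ders_def)
  ultimately have "I \<in> Der \<Gamma>" "A \<in> Der \<Gamma>" "B \<in> Der \<Gamma>" "C \<in> Der \<Gamma>" "E \<in> Der \<Gamma>"
    using outer_in_Der[OF assms(1)] by blast+
  then show "D \<in> Der \<Gamma>"
    unfolding D by (intro Der_add[OF assms(1)])
qed (rule outer_direct_sum[OF assms(1)])

end
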